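(* Let $(W,S)$ be a right-angled Coxeter system with $|S|\geq 3$ and $m(s,t)=\infty$ for all $s\neq t$ in $S$, and let $q>0$. Then the Hecke von Neumann algebra $\mathcal{M}_q$ is not injective.
   Context: $(W,S)$: $S$ finite, $m(s,s)=1$, $m(s,t)=m(t,s)\in\{2,\infty\}$ for $s\neq t$, $W=\langle S\mid (st)^{m(s,t)}=1\rangle$ (no relation when $m=\infty$); $|\mathbf{w}|$ word length. For $q>0$, $p=(q-1)/\sqrt q$; the Hecke algebra has linear basis $\{T_{\mathbf{w}}\}_{\mathbf{w}\in W}$, $T_e=1$, $T_sT_{\mathbf{w}}=T_{s\mathbf{w}}$ if $|s\mathbf{w}|>|\mathbf{w}|$ and $T_{s\mathbf{w}}+pT_{\mathbf{w}}$ otherwise, $T_{\mathbf{w}}^*=T_{\mathbf{w}^{-1}}$; $\mathcal{M}_q$ is the von Neumann algebra it generates in the GNS representation of the faithful tracial state $\tau(T_{\mathbf{w}})=\delta_{\mathbf{w},e}$. A von Neumann algebra $\mathcal{M}\subseteq\mathcal{B}(\mathcal{H})$ is injective if there is a (not necessarily normal) conditional expectation $\mathcal{B}(\mathcal{H})\to\mathcal{M}$. *)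

theory Defs
  imports "HOL-Analysis.Analysis"
begin

text \<open>Right-angled Coxeter group with m(s,t) = infinity for all s /= t, i.e. the free
product of copies of Z/2 indexed by S, realised by its normal forms: words over S with
no two consecutive equal letters.  The empty word is the identity, word length is
list length.\<close>

definition reduced_word :: "'a set \<Rightarrow> 'a list \<Rightarrow> bool" where
  "reduced_word S ws \<longleftrightarrow> set ws \<subseteq> S \<and> (\<forall>i. Suc i < length ws \<longrightarrow> ws ! i \<noteq> ws ! Suc i)"

definition coxW :: "'a set \<Rightarrow> 'a list set" where
  "coxW S = {ws. reduced_word S ws}"

definition lmul :: "'a \<Rightarrow> 'a list \<Rightarrow> 'a list" where
  "lmul s w = (if w \<noteq> [] \<and> hd w = s then tl w else s # w)"

text \<open>The GNS Hilbert space of the trace: l2(W) (orthonormal basis T_w).\<close>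
definition l2 :: "'a set \<Rightarrow> ('a list \<Rightarrow> complex) set" where
  "l2 S = {f. (\<forall>w. w \<notin> coxW S \<longrightarrow> f w = 0) \<and> (\<lambda>w. (cmod (f w))\<^sup>2) summable_on coxW S}"

definition l2norm :: "'a set \<Rightarrow> ('a list \<Rightarrow> complex) \<Rightarrow> real" where
  "l2norm S f = sqrt (\<Sum>\<^sub>\<infinity>w\<in>coxW S. (cmod (f w))\<^sup>2)"

definition bounded_ops :: "'a set \<Rightarrow> (('a list \<Rightarrow> complex) \<Rightarrow> ('a list \<Rightarrow> complex)) set" where
  "bounded_ops S = {A.
      (\<forall>f\<in>l2 S. A f \<in> l2 S) \<and>
      (\<forall>f\<in>l2 S. \<forall>g\<in>l2 S. \<forall>c d :: complex.
          A (\<lambda>w. c * f w + d * g w) = (\<lambda>w. c * A f w + d * A g w)) \<and>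
      (\<exists>C. \<forall>f\<in>l2 S. l2norm S (A f) \<le> C * l2norm S f) \<and>
      (\<forall>f. f \<notin> l2 S \<longrightarrow> A f = (\<lambda>_. 0))}"

definition op_norm :: "'a set \<Rightarrow> (('a list \<Rightarrow> complex) \<Rightarrow> ('a list \<Rightarrow> complex)) \<Rightarrow> real" where
  "op_norm S A = Sup ((\<lambda>f. l2norm S (A f)) ` {f \<in> l2 S. l2norm S f \<le> 1})"

definition commutant ::
  "'a set \<Rightarrow> (('a list \<Rightarrow> complex) \<Rightarrow> ('a list \<Rightarrow> complex)) set
     \<Rightarrow> (('a list \<Rightarrow> complex) \<Rightarrow> ('a list \<Rightarrow> complex)) set" where
  "commutant S X = {B \<in> bounded_ops S. \<forall>A\<in>X. \<forall>f\<in>l2 S. A (B f) = B (A f)}"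

definition hecke_p :: "real \<Rightarrow> real" where
  "hecke_p q = (q - 1) / sqrt q"

text \<open>The operator of left multiplication by T_s in the GNS representation:
  T_s delta_w = delta_(sw) if |sw| > |w|, and delta_(sw) + p delta_w otherwise;
  hence (T_s f)(v) = f(sv) + [|sv| < |v|] p f(v).\<close>
definition hecke_gen :: "'a set \<Rightarrow> real \<Rightarrow> 'a \<Rightarrow> ('a list \<Rightarrow> complex) \<Rightarrow> ('a list \<Rightarrow> complex)" where
  "hecke_gen S q s f =
     (if f \<in> l2 S then
        (\<lambda>v. if v \<in> coxW S then
                f (lmul s v) + (if length (lmul s v) < length v then complex_of_real (hecke_p q) * f v else 0)
              else 0)
      else (\<lambda>_. 0))"

text \<open>The Hecke von Neumann algebra M_q: the bicommutant of the self-adjoint generating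
set {T_s : s in S} (equivalently of {T_w : w in W}).\<close>
definition hecke_vNa :: "'a set \<Rightarrow> real \<Rightarrow> (('a list \<Rightarrow> complex) \<Rightarrow> ('a list \<Rightarrow> complex)) set" where
  "hecke_vNa S q = commutant S (commutant S (hecke_gen S q ` S))"

text \<open>Conditional expectation B(H) -> M: a linear projection of norm one onto M
(not required to be normal).\<close>
definition cond_exp ::
  "'a set \<Rightarrow> (('a list \<Rightarrow> complex) \<Rightarrow> ('a list \<Rightarrow> complex)) set
     \<Rightarrow> ((('a list \<Rightarrow> complex) \<Rightarrow> ('a list \<Rightarrow> complex)) \<Rightarrow> (('a list \<Rightarrow> complex) \<Rightarrow> ('a list \<Rightarrow> complex)))
     \<Rightarrow> bool" where
  "cond_exp S M E \<longleftrightarrow>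
     (\<forall>x\<in>bounded_ops S. E x \<in> M) \<and>
     (\<forall>x\<in>M. E x = x) \<and>
     (\<forall>x\<in>bounded_ops S. \<forall>y\<in>bounded_ops S. \<forall>c d :: complex.
        E (\<lambda>f w. c * x f w + d * y f w) = (\<lambda>f w. c * E x f w + d * E y f w)) \<and>
     (\<forall>x\<in>bounded_ops S. op_norm S (E x) \<le> op_norm S x)"

definition injective_vNa ::
  "'a set \<Rightarrow> (('a list \<Rightarrow> complex) \<Rightarrow> ('a list \<Rightarrow> complex)) set \<Rightarrow> bool" where
  "injective_vNa S M \<longleftrightarrow> (\<exists>E. cond_exp S M E)"

end

theory Submission
  imports Defs
begin

text \<open>By Tomiyama's argument a norm-one projection \<open>E\<close> onto \<open>M\<^sub>q\<close> satisfies \<open>E (p x) = p E(x)\<close> and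
  \<open>E (x p) = E(x) p\<close> for projections \<open>p\<close> in \<open>M\<^sub>q\<close>, so the state
  \<open>\<phi> = \<tau> \<circ> E\<close> on all bounded operators is tracial against \<open>M\<^sub>q\<close> and restricts to \<open>\<tau>\<close>;
  in particular \<open>\<phi>(x) = \<phi>(p x p) + \<phi>((1 - p) x (1 - p))\<close>.
  Let \<open>P\<^sub>s\<close> be the projection onto the words starting with \<open>s\<close> and \<open>P\<close> the projection onto the empty
  word, so that \<open>\<phi>(P) + (\<Sum>s. \<phi>(P\<^sub>s)) = 1\<close>. Compressing \<open>P\<^sub>s\<close> by the spectral projections of \<open>T\<^sub>s\<close> gives
  \<open>\<phi>(P\<^sub>s) = 2 q / (1 + q)\<^sup>2\<close>. With \<open>x = min q (1/q)\<close> and \<open>n = card S\<close>, these values alone sum to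
  more than 1 if \<open>(n - 1) x \<ge> 1\<close>. Otherwise \<open>\<eta>(w) = c\<close> to the power \<open>length w\<close>, with \<open>c\<^sup>2 = x\<close>, is a
  square-summable joint eigenvector of the \<open>T\<^sub>s\<close>; its projection is central in \<open>M\<^sub>q\<close> and compressing by it
  yields \<open>\<phi>(P) \<ge> ((1 - (n - 1) x) / (1 + x))\<^sup>2\<close>, and the sum exceeds 1 again because \<open>n \<ge> 3\<close>.\<close>

section \<open>Words\<close>

lemma reduced_word_altdef: "reduced_word S ws \<longleftrightarrow> set ws \<subseteq> S \<and> distinct_adj ws"
  unfolding reduced_word_def distinct_adj_conv_nth by (auto simp: less_diff_conv)

lemma Nil_in_coxW [simp]: "[] \<in> coxW S"
  by (simp add: coxW_def reduced_word_altdef)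

lemma Cons_in_coxW: "s # w \<in> coxW S \<longleftrightarrow> s \<in> S \<and> w \<in> coxW S \<and> (w = [] \<or> hd w \<noteq> s)"
  by (auto simp: coxW_def reduced_word_altdef distinct_adj_Cons)

lemma rev_in_coxW [simp]: "rev w \<in> coxW S \<longleftrightarrow> w \<in> coxW S"
  by (simp add: coxW_def reduced_word_altdef)

definition starts :: "'a \<Rightarrow> 'a list \<Rightarrow> bool" where
  "starts s w \<longleftrightarrow> w \<noteq> [] \<and> hd w = s"

lemma lmul_in_coxW:
  assumes "s \<in> S" "w \<in> coxW S"
  shows "lmul s w \<in> coxW S"
  using assms by (cases w) (auto simp: lmul_def Cons_in_coxW)

text \<open>A reduced word has no doubled letter: once a leading s is cancelled, the rest does not
  start with s, so the second multiplication puts s back.\<close>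

lemma lmul_lmul:
  assumes "w \<in> coxW S"
  shows "lmul s (lmul s w) = w"
  using assms by (cases w) (auto simp: lmul_def Cons_in_coxW)

lemma starts_lmul:
  assumes "w \<in> coxW S"
  shows "starts s (lmul s w) \<longleftrightarrow> \<not> starts s w"
  using assms by (cases w) (auto simp: lmul_def starts_def Cons_in_coxW)

lemma length_lmul_less_iff: "length (lmul s w) < length w \<longleftrightarrow> starts s w"
  by (cases w) (auto simp: lmul_def starts_def)

lemma bij_betw_lmul:
  assumes "s \<in> S"
  shows "bij_betw (lmul s) (coxW S) (coxW S)"
  by (rule bij_betw_byWitness[of _ "lmul s"]) (use assms in \<open>auto simp: lmul_lmul lmul_in_coxW\<close>)

lemma bij_betw_rev_coxW: "bij_betw rev (coxW S) (coxW S)"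
  by (rule bij_betw_byWitness[of _ rev]) auto

section \<open>The Hilbert space\<close>

definition ip :: "'a set \<Rightarrow> ('a list \<Rightarrow> complex) \<Rightarrow> ('a list \<Rightarrow> complex) \<Rightarrow> complex" where
  "ip S f g = (\<Sum>\<^sub>\<infinity>w\<in>coxW S. f w * cnj (g w))"

lemma l2_outside: "f \<in> l2 S \<Longrightarrow> w \<notin> coxW S \<Longrightarrow> f w = 0"
  by (simp add: l2_def)

lemma l2_summable: "f \<in> l2 S \<Longrightarrow> (\<lambda>w. (cmod (f w))\<^sup>2) summable_on coxW S"
  by (simp add: l2_def)

lemma l2_comparison:
  assumes "g summable_on coxW S"
    and "\<And>w. w \<in> coxW S \<Longrightarrow> (cmod (f w))\<^sup>2 \<le> g w"
    and "\<And>w. w \<notin> coxW S \<Longrightarrow> f w = 0"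
  shows "f \<in> l2 S"
  unfolding l2_def using assms by (auto intro: summable_on_comparison_test)

lemma cmod_add_sq_le: "(cmod (a + b))\<^sup>2 \<le> 2 * (cmod a)\<^sup>2 + 2 * (cmod b)\<^sup>2"
proof -
  have "(cmod (a + b))\<^sup>2 \<le> (cmod a + cmod b)\<^sup>2"
    by (intro power_mono norm_triangle_ineq) auto
  also have "\<dots> \<le> 2 * (cmod a)\<^sup>2 + 2 * (cmod b)\<^sup>2"
    using sum_squares_bound[of "cmod a" "cmod b"] by (simp add: power2_sum)
  finally show ?thesis .
qed

lemma l2_lin:
  assumes "f \<in> l2 S" "g \<in> l2 S"
  shows "(\<lambda>w. c * f w + d * g w) \<in> l2 S"
proof (rule l2_comparison)
  show "(\<lambda>w. 2 * (cmod c)\<^sup>2 * (cmod (f w))\<^sup>2 + 2 * (cmod d)\<^sup>2 * (cmod (g w))\<^sup>2) summable_on coxW S"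
    by (intro assms summable_on_add summable_on_cmult_right l2_summable)
  show "(cmod (c * f w + d * g w))\<^sup>2 \<le> 2 * (cmod c)\<^sup>2 * (cmod (f w))\<^sup>2 + 2 * (cmod d)\<^sup>2 * (cmod (g w))\<^sup>2" for w
    using cmod_add_sq_le[of "c * f w" "d * g w"] by (simp add: norm_mult power_mult_distrib)
qed (use assms in \<open>auto simp: l2_outside\<close>)

lemma l2_zero [simp]: "(\<lambda>_. 0) \<in> l2 S"
  by (simp add: l2_def)

lemma l2_scale: "f \<in> l2 S \<Longrightarrow> (\<lambda>w. c * f w) \<in> l2 S"
  using l2_lin[of f S f c 0] by simp

lemma l2_add: "f \<in> l2 S \<Longrightarrow> g \<in> l2 S \<Longrightarrow> (\<lambda>w. f w + g w) \<in> l2 S"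
  using l2_lin[of f S g 1 1] by simp

lemma l2_diff: "f \<in> l2 S \<Longrightarrow> g \<in> l2 S \<Longrightarrow> (\<lambda>w. f w - g w) \<in> l2 S"
  using l2_lin[of f S g 1 "-1"] by simp

lemma ip_abs_summable:
  assumes "f \<in> l2 S" "g \<in> l2 S"
  shows "(\<lambda>w. cmod (f w * cnj (g w))) summable_on coxW S"
proof (rule summable_on_comparison_test)
  show "(\<lambda>w. (cmod (f w))\<^sup>2 + (cmod (g w))\<^sup>2) summable_on coxW S"
    by (intro assms summable_on_add l2_summable)
  show "cmod (f w * cnj (g w)) \<le> (cmod (f w))\<^sup>2 + (cmod (g w))\<^sup>2" for w
    using sum_squares_bound[of "cmod (f w)" "cmod (g w)"] mult_nonneg_nonneg[OF norm_ge_zero[of "f w"] norm_ge_zero[of "g w"]]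
    unfolding norm_mult complex_mod_cnj by linarith
qed auto

lemma ip_summable: "f \<in> l2 S \<Longrightarrow> g \<in> l2 S \<Longrightarrow> (\<lambda>w. f w * cnj (g w)) summable_on coxW S"
  by (rule abs_summable_summable) (rule ip_abs_summable)

lemma ip_lin_left:
  assumes "f \<in> l2 S" "g \<in> l2 S" "h \<in> l2 S"
  shows "ip S (\<lambda>w. c * f w + d * g w) h = c * ip S f h + d * ip S g h"
proof -
  have "ip S (\<lambda>w. c * f w + d * g w) h
      = (\<Sum>\<^sub>\<infinity>w\<in>coxW S. c * (f w * cnj (h w)) + d * (g w * cnj (h w)))"
    unfolding ip_def by (simp add: algebra_simps)
  also have "\<dots> = c * ip S f h + d * ip S g h"
    unfolding ip_def
    by (subst infsum_add) (auto intro!: summable_on_cmult_right ip_summable assms simp: infsum_cmult_right')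
  finally show ?thesis .
qed

lemma ip_cnj: "ip S g f = cnj (ip S f g)"
  unfolding ip_def by (subst infsum_cnj[symmetric]) (simp add: mult.commute)

lemma ip_lin_right:
  assumes "f \<in> l2 S" "g \<in> l2 S" "h \<in> l2 S"
  shows "ip S h (\<lambda>w. c * f w + d * g w) = cnj c * ip S h f + cnj d * ip S h g"
  unfolding ip_cnj[of S h] by (simp add: ip_lin_left assms)

lemma ip_scale_left: "f \<in> l2 S \<Longrightarrow> g \<in> l2 S \<Longrightarrow> ip S (\<lambda>w. c * f w) g = c * ip S f g"
  using ip_lin_left[of f S f g c 0] by simp

lemma ip_diff_left: "f \<in> l2 S \<Longrightarrow> g \<in> l2 S \<Longrightarrow> h \<in> l2 S \<Longrightarrow>
    ip S (\<lambda>w. f w - g w) h = ip S f h - ip S g h"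
  using ip_lin_left[of f S g h 1 "-1"] by simp

lemma ip_diff_right: "f \<in> l2 S \<Longrightarrow> g \<in> l2 S \<Longrightarrow> h \<in> l2 S \<Longrightarrow>
    ip S h (\<lambda>w. f w - g w) = ip S h f - ip S h g"
  using ip_lin_right[of f S g h 1 "-1"] by simp

lemma l2norm_nonneg [simp]: "0 \<le> l2norm S f"
  unfolding l2norm_def by (simp add: infsum_nonneg)

lemma l2norm_sq: "(l2norm S f)\<^sup>2 = (\<Sum>\<^sub>\<infinity>w\<in>coxW S. (cmod (f w))\<^sup>2)"
  unfolding l2norm_def by (simp add: infsum_nonneg)

lemma ip_self: "f \<in> l2 S \<Longrightarrow> ip S f f = complex_of_real ((l2norm S f)\<^sup>2)"
  unfolding ip_def l2norm_sq complex_norm_square[symmetric]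
  by (intro infsumI has_sum_of_real_iff[THEN iffD2] has_sum_infsum l2_summable)

lemma sum_le_l2norm_sq:
  assumes "f \<in> l2 S" "F \<subseteq> coxW S" "finite F"
  shows "(\<Sum>w\<in>F. (cmod (f w))\<^sup>2) \<le> (l2norm S f)\<^sup>2"
  unfolding l2norm_sq by (rule finite_sum_le_infsum) (use assms in \<open>auto simp: l2_summable\<close>)

lemma cmod_le_l2norm:
  assumes "f \<in> l2 S" "w \<in> coxW S"
  shows "cmod (f w) \<le> l2norm S f"
  using sum_le_l2norm_sq[of f S "{w}"] assms by (simp add: abs_le_square_iff[symmetric])

lemma l2norm_eq_0: "f \<in> l2 S \<Longrightarrow> l2norm S f = 0 \<Longrightarrow> f = (\<lambda>_. 0)"
  using cmod_le_l2norm[of f S] l2_outside[of f S] by (metis norm_le_zero_iff)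

text \<open>Cauchy-Schwarz: the finite partial sums obey \<open>L2_set_mult_ineq\<close> with the
  full norms as bounds, and the estimate passes to the infinite sum.\<close>

lemma ip_le:
  assumes "f \<in> l2 S" "g \<in> l2 S"
  shows "cmod (ip S f g) \<le> l2norm S f * l2norm S g"
proof -
  have "cmod (ip S f g) \<le> (\<Sum>\<^sub>\<infinity>w\<in>coxW S. cmod (f w * cnj (g w)))"
    unfolding ip_def by (rule norm_infsum_bound) (rule ip_abs_summable assms)+
  also have "\<dots> \<le> l2norm S f * l2norm S g"
  proof (rule infsum_le_finite_sums)
    fix F assume F: "finite F" "F \<subseteq> coxW S"
    have "(\<Sum>w\<in>F. cmod (f w * cnj (g w))) \<le> L2_set (\<lambda>w. cmod (f w)) F * L2_set (\<lambda>w. cmod (g w)) F"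
      using L2_set_mult_ineq[of "\<lambda>w. cmod (f w)" "\<lambda>w. cmod (g w)" F] by (simp add: norm_mult)
    also have "\<dots> \<le> l2norm S f * l2norm S g"
      by (intro mult_mono L2_set_nonneg l2norm_nonneg)
        (auto simp: L2_set_def intro!: real_le_lsqrt sum_le_l2norm_sq assms F)
    finally show "(\<Sum>w\<in>F. cmod (f w * cnj (g w))) \<le> l2norm S f * l2norm S g" .
  qed (rule ip_abs_summable assms)+
  finally show ?thesis .
qed

lemma l2norm_add_sq:
  assumes "f \<in> l2 S" "g \<in> l2 S"
  shows "(l2norm S (\<lambda>w. f w + g w))\<^sup>2 = (l2norm S f)\<^sup>2 + (l2norm S g)\<^sup>2 + 2 * Re (ip S f g)"
proof -
  have "ip S (\<lambda>w. 1 * f w + 1 * g w) (\<lambda>w. 1 * f w + 1 * g w)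
      = ip S f f + ip S g g + (ip S f g + cnj (ip S f g))"
    by (simp only: ip_lin_left ip_lin_right l2_lin assms) (simp add: ip_cnj[of S g f])
  then have "Re (ip S (\<lambda>w. f w + g w) (\<lambda>w. f w + g w))
      = Re (ip S f f) + Re (ip S g g) + 2 * Re (ip S f g)" by simp
  then show ?thesis by (simp add: ip_self assms l2_add)
qed

lemma l2norm_triangle:
  assumes "f \<in> l2 S" "g \<in> l2 S"
  shows "l2norm S (\<lambda>w. f w + g w) \<le> l2norm S f + l2norm S g"
proof (rule power2_le_imp_le)
  show "(l2norm S (\<lambda>w. f w + g w))\<^sup>2 \<le> (l2norm S f + l2norm S g)\<^sup>2"
    using ip_le[OF assms] complex_Re_le_cmod[of "ip S f g"]
    by (simp add: l2norm_add_sq assms power2_sum)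
qed simp

lemma l2norm_scale: "l2norm S (\<lambda>w. c * f w) = cmod c * l2norm S f"
  unfolding l2norm_def
  by (simp add: norm_mult power_mult_distrib infsum_cmult_right' real_sqrt_mult)

section \<open>Bounded operators\<close>

lemma bopD:
  assumes "A \<in> bounded_ops S"
  shows bop_l2: "f \<in> l2 S \<Longrightarrow> A f \<in> l2 S"
    and bop_lin: "f \<in> l2 S \<Longrightarrow> g \<in> l2 S \<Longrightarrow>
          A (\<lambda>w. c * f w + d * g w) = (\<lambda>w. c * A f w + d * A g w)"
    and bop_outside: "f \<notin> l2 S \<Longrightarrow> A f = (\<lambda>_. 0)"
  using assms unfolding bounded_ops_def by blast+

lemma bop_bound:
  assumes "A \<in> bounded_ops S"
  obtains C where "C \<ge> 0" "\<And>f. f \<in> l2 S \<Longrightarrow> l2norm S (A f) \<le> C * l2norm S f"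
proof -
  obtain C where C: "\<And>f. f \<in> l2 S \<Longrightarrow> l2norm S (A f) \<le> C * l2norm S f"
    using assms unfolding bounded_ops_def by blast
  have "l2norm S (A f) \<le> max C 0 * l2norm S f" if "f \<in> l2 S" for f
    by (rule order.trans[OF C[OF that]]) (auto intro: mult_right_mono)
  then show ?thesis by (intro that[of "max C 0"]) auto
qed

lemma bopI:
  assumes "\<And>f. f \<in> l2 S \<Longrightarrow> A f \<in> l2 S"
    and "\<And>f g c d. f \<in> l2 S \<Longrightarrow> g \<in> l2 S \<Longrightarrow>
          A (\<lambda>w. c * f w + d * g w) = (\<lambda>w. c * A f w + d * A g w)"
    and "\<And>f. f \<in> l2 S \<Longrightarrow> l2norm S (A f) \<le> C * l2norm S f"
    and "\<And>f. f \<notin> l2 S \<Longrightarrow> A f = (\<lambda>_. 0)"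
  shows "A \<in> bounded_ops S"
  using assms unfolding bounded_ops_def by blast

lemma bop_zero: "A \<in> bounded_ops S \<Longrightarrow> A (\<lambda>_. 0) = (\<lambda>_. 0)"
  using bop_lin[of A S "\<lambda>_. 0" "\<lambda>_. 0" 0 0] by simp

lemma bop_scale: "A \<in> bounded_ops S \<Longrightarrow> f \<in> l2 S \<Longrightarrow> A (\<lambda>w. c * f w) = (\<lambda>w. c * A f w)"
  using bop_lin[of A S f f c 0] by simp

lemma bop_add: "A \<in> bounded_ops S \<Longrightarrow> f \<in> l2 S \<Longrightarrow> g \<in> l2 S \<Longrightarrow>
    A (\<lambda>w. f w + g w) = (\<lambda>w. A f w + A g w)"
  using bop_lin[of A S f g 1 1] by simp

lemma bop_diff: "A \<in> bounded_ops S \<Longrightarrow> f \<in> l2 S \<Longrightarrow> g \<in> l2 S \<Longrightarrow>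
    A (\<lambda>w. f w - g w) = (\<lambda>w. A f w - A g w)"
  using bop_lin[of A S f g 1 "-1"] by simp

lemma bop_comp:
  assumes "A \<in> bounded_ops S" "B \<in> bounded_ops S"
  shows "A \<circ> B \<in> bounded_ops S"
proof -
  obtain C where C: "C \<ge> 0" "\<And>f. f \<in> l2 S \<Longrightarrow> l2norm S (A f) \<le> C * l2norm S f"
    using bop_bound[OF assms(1)] by blast
  obtain D where D: "D \<ge> 0" "\<And>f. f \<in> l2 S \<Longrightarrow> l2norm S (B f) \<le> D * l2norm S f"
    using bop_bound[OF assms(2)] by blast
  show ?thesis
  proof (rule bopI)
    fix f assume f: "f \<in> l2 S"
    have "l2norm S (A (B f)) \<le> C * l2norm S (B f)"
      by (intro C bop_l2[OF assms(2)] f)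
    also have "\<dots> \<le> C * (D * l2norm S f)"
      by (intro f mult_left_mono C D)
    finally show "l2norm S ((A \<circ> B) f) \<le> (C * D) * l2norm S f"
      by simp
  qed (use assms in \<open>auto simp: bop_l2 assms[THEN bop_lin] assms[THEN bop_outside] bop_zero\<close>)
qed

text \<open>A name for the linear combination written out in \<open>cond_exp\<close>, so that
  linearity of an expectation becomes an equation between operators.\<close>

definition oplin :: "complex \<Rightarrow> (('a list \<Rightarrow> complex) \<Rightarrow> ('a list \<Rightarrow> complex)) \<Rightarrow> complex
    \<Rightarrow> (('a list \<Rightarrow> complex) \<Rightarrow> ('a list \<Rightarrow> complex)) \<Rightarrow> ('a list \<Rightarrow> complex) \<Rightarrow> ('a list \<Rightarrow> complex)" where
  "oplin c A d B = (\<lambda>f w. c * A f w + d * B f w)"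

lemma bop_oplin:
  assumes "A \<in> bounded_ops S" "B \<in> bounded_ops S"
  shows "oplin c A d B \<in> bounded_ops S"
proof -
  obtain C where C: "C \<ge> 0" "\<And>f. f \<in> l2 S \<Longrightarrow> l2norm S (A f) \<le> C * l2norm S f"
    using bop_bound[OF assms(1)] by blast
  obtain D where D: "D \<ge> 0" "\<And>f. f \<in> l2 S \<Longrightarrow> l2norm S (B f) \<le> D * l2norm S f"
    using bop_bound[OF assms(2)] by blast
  show ?thesis
  proof (rule bopI)
    fix f assume f: "f \<in> l2 S"
    have "l2norm S (oplin c A d B f) \<le> l2norm S (\<lambda>w. c * A f w) + l2norm S (\<lambda>w. d * B f w)"
      unfolding oplin_def by (rule l2norm_triangle[OF assms[THEN bop_l2, OF f, THEN l2_scale]])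
    also have "\<dots> \<le> cmod c * (C * l2norm S f) + cmod d * (D * l2norm S f)"
      unfolding l2norm_scale using C(2)[OF f] D(2)[OF f] by (simp add: add_mono mult_left_mono)
    finally show "l2norm S (oplin c A d B f) \<le> (cmod c * C + cmod d * D) * l2norm S f"
      by (simp only: distrib_right mult.assoc)
  next
    fix f g a b assume fg: "f \<in> l2 S" "g \<in> l2 S"
    show "oplin c A d B (\<lambda>w. a * f w + b * g w) = (\<lambda>w. a * oplin c A d B f w + b * oplin c A d B g w)"
      unfolding oplin_def bop_lin[OF assms(1) fg] bop_lin[OF assms(2) fg]
      by (simp add: algebra_simps)
  next
    show "oplin c A d B f \<in> l2 S" if "f \<in> l2 S" for f
      unfolding oplin_def by (rule l2_lin[OF assms[THEN bop_l2, OF that]])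
  next
    show "oplin c A d B f = (\<lambda>_. 0)" if "f \<notin> l2 S" for f
      by (simp add: oplin_def assms[THEN bop_outside, OF that])
  qed
qed

text \<open>Set to zero off \<open>l2 S\<close>, as \<open>bounded_ops\<close> demands of its
  members; the identity function on all of the type would not be one.\<close>

definition idop :: "'a set \<Rightarrow> ('a list \<Rightarrow> complex) \<Rightarrow> ('a list \<Rightarrow> complex)" where
  "idop S f = (if f \<in> l2 S then f else (\<lambda>_. 0))"

lemma idop_apply [simp]: "f \<in> l2 S \<Longrightarrow> idop S f = f"
  by (simp add: idop_def)

lemma bop_idop: "idop S \<in> bounded_ops S"
  by (rule bopI[where C = 1]) (auto simp: idop_def l2_lin)

text \<open>The zero convention off \<open>l2 S\<close> makes agreement on the Hilbert space enough
  for equality of functions.\<close>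

lemma bop_ext:
  assumes "A \<in> bounded_ops S" "B \<in> bounded_ops S" "\<And>f. f \<in> l2 S \<Longrightarrow> A f = B f"
  shows "A = B"
proof
  show "A f = B f" for f
    using assms(3)[of f] bop_outside[OF assms(1), of f] bop_outside[OF assms(2), of f] by argo
qed

section \<open>The operator norm\<close>

lemma op_norm_bdd_above:
  assumes "A \<in> bounded_ops S"
  shows "bdd_above ((\<lambda>f. l2norm S (A f)) ` {f \<in> l2 S. l2norm S f \<le> 1})"
proof -
  obtain C where C: "C \<ge> 0" "\<And>f. f \<in> l2 S \<Longrightarrow> l2norm S (A f) \<le> C * l2norm S f"
    using bop_bound[OF assms] by blast
  show ?thesis
  proof (rule bdd_aboveI2)
    fix h assume "h \<in> {f \<in> l2 S. l2norm S f \<le> 1}"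
    then show "l2norm S (A h) \<le> C"
      using C(2)[of h] mult_left_mono[of "l2norm S h" 1 C] C(1) by auto
  qed
qed

lemma op_norm_bound:
  assumes "A \<in> bounded_ops S" "f \<in> l2 S"
  shows "l2norm S (A f) \<le> op_norm S A * l2norm S f"
proof (cases "l2norm S f = 0")
  case True
  then show ?thesis using l2norm_eq_0[OF assms(2)] bop_zero[OF assms(1)] by simp
next
  case False
  let ?g = "\<lambda>w. complex_of_real (1 / l2norm S f) * f w"
  have g: "?g \<in> l2 S" "l2norm S ?g \<le> 1"
    using False by (auto simp: l2norm_scale norm_divide simp del: of_real_divide intro!: l2_scale assms)
  have "l2norm S (A ?g) \<le> op_norm S A"
    unfolding op_norm_def
    by (rule cSUP_upper[OF _ op_norm_bdd_above[OF assms(1)]]) (use g in auto)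
  moreover have "l2norm S (A ?g) = l2norm S (A f) / l2norm S f"
    using bop_scale[OF assms, of "complex_of_real (1 / l2norm S f)"]
      l2norm_scale[of S "complex_of_real (1 / l2norm S f)" "A f"]
    by (simp only: norm_of_real) simp
  ultimately show ?thesis using False l2norm_nonneg[of S f]
    by (simp add: divide_le_eq less_le)
qed

lemma op_norm_le:
  assumes "\<And>f. f \<in> l2 S \<Longrightarrow> l2norm S (A f) \<le> C * l2norm S f" "C \<ge> 0"
  shows "op_norm S A \<le> C"
  unfolding op_norm_def
proof (rule cSUP_least)
  have "(\<lambda>_. 0) \<in> {f \<in> l2 S. l2norm S f \<le> 1}" by (simp add: l2norm_def)
  then show "{f \<in> l2 S. l2norm S f \<le> 1} \<noteq> {}" by blast
  fix h assume "h \<in> {f \<in> l2 S. l2norm S f \<le> 1}"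
  then show "l2norm S (A h) \<le> C"
    using assms(1)[of h] mult_left_mono[of "l2norm S h" 1 C] assms(2) by auto
qed

lemma op_norm_nonneg:
  assumes "A \<in> bounded_ops S"
  shows "0 \<le> op_norm S A"
proof -
  have "(\<lambda>_. 0) \<in> {f \<in> l2 S. l2norm S f \<le> 1}" by (simp add: l2norm_def)
  then have "l2norm S (A (\<lambda>_. 0)) \<le> op_norm S A"
    unfolding op_norm_def by (rule cSUP_upper[OF _ op_norm_bdd_above[OF assms]])
  then show ?thesis using l2norm_nonneg[of S "A (\<lambda>_. 0)"] by linarith
qed

lemma op_norm_eq_0:
  assumes "A \<in> bounded_ops S" "op_norm S A = 0"
  shows "A f = (\<lambda>_. 0)"
proof (cases "f \<in> l2 S")
  case True
  then have "l2norm S (A f) = 0"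
    using op_norm_bound[OF assms(1) True] assms(2) l2norm_nonneg[of S "A f"] by simp
  then show ?thesis
    by (rule l2norm_eq_0[OF bop_l2[OF assms(1) True]])
qed (simp add: bop_outside[OF assms(1)])

section \<open>Projections and rank-one operators\<close>

text \<open>Orthogonal projections, with self-adjointness expressed through the inner product
  instead of an adjoint operation.\<close>

definition adj_proj :: "'a set \<Rightarrow> (('a list \<Rightarrow> complex) \<Rightarrow> ('a list \<Rightarrow> complex)) \<Rightarrow> bool" where
  "adj_proj S p \<longleftrightarrow> p \<in> bounded_ops S \<and> (\<forall>f\<in>l2 S. p (p f) = p f) \<and>
     (\<forall>f\<in>l2 S. \<forall>g\<in>l2 S. ip S (p f) g = ip S f (p g))"

definition compl_op where
  "compl_op S p = oplin 1 (idop S) (-1) p"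

lemma compl_op_apply: "f \<in> l2 S \<Longrightarrow> compl_op S p f = (\<lambda>w. f w - p f w)"
  by (simp add: compl_op_def oplin_def)

lemma adj_projD:
  assumes "adj_proj S p"
  shows proj_bop: "p \<in> bounded_ops S"
    and proj_idem: "f \<in> l2 S \<Longrightarrow> p (p f) = p f"
    and proj_adj: "f \<in> l2 S \<Longrightarrow> g \<in> l2 S \<Longrightarrow> ip S (p f) g = ip S f (p g)"
  using assms by (auto simp: adj_proj_def)

text \<open>Allows a statement about projections to be applied to the complement of p and read back
  in terms of p, as in \<open>E_left_mult\<close>.\<close>

lemma compl_op_compl_op:
  assumes "p \<in> bounded_ops S"
  shows "compl_op S (compl_op S p) = p"
  using bop_oplin[OF bop_idop assms] assms bop_outside[OF assms]
  by (auto simp: compl_op_def oplin_def idop_def fun_eq_iff)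

lemma adj_proj_compl:
  assumes "adj_proj S p"
  shows "adj_proj S (compl_op S p)"
proof -
  note p = adj_projD[OF assms] bop_l2[OF adj_projD(1)[OF assms]]
  have "compl_op S p \<in> bounded_ops S"
    unfolding compl_op_def by (intro p bop_oplin bop_idop)
  then show ?thesis
    unfolding adj_proj_def
    by (auto simp: compl_op_apply p l2_diff bop_diff[OF p(1)] ip_diff_left ip_diff_right)
qed

lemma proj_compl_eq_0:
  assumes "adj_proj S p" "f \<in> l2 S"
  shows "p (compl_op S p f) = (\<lambda>_. 0)"
  using assms bop_diff[OF proj_bop[OF assms(1)] assms(2) bop_l2[OF proj_bop[OF assms(1)] assms(2)]]
  by (simp add: compl_op_apply proj_idem[OF assms(1)])

text \<open>The two components are orthogonal: self-adjointness moves p onto the second one, which p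
  annihilates.\<close>

lemma proj_pythagoras:
  assumes "adj_proj S p" "f \<in> l2 S"
  shows "(l2norm S f)\<^sup>2 = (l2norm S (p f))\<^sup>2 + (l2norm S (compl_op S p f))\<^sup>2"
proof -
  note p = adj_projD[OF assms(1)]
  note q = adj_projD[OF adj_proj_compl[OF assms(1)]]
  have l2: "p f \<in> l2 S" "compl_op S p f \<in> l2 S"
    by (rule bop_l2[OF p(1) assms(2)], rule bop_l2[OF q(1) assms(2)])
  have "ip S (p f) (compl_op S p f) = ip S f (p (compl_op S p f))"
    by (rule p(3)[OF assms(2) l2(2)])
  also have "\<dots> = 0"
    by (simp add: proj_compl_eq_0[OF assms] ip_def)
  finally have "(l2norm S (\<lambda>w. p f w + compl_op S p f w))\<^sup>2
      = (l2norm S (p f))\<^sup>2 + (l2norm S (compl_op S p f))\<^sup>2"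
    using l2norm_add_sq[OF l2] by simp
  then show ?thesis by (simp add: compl_op_apply assms)
qed

lemma proj_norm_le:
  assumes "adj_proj S p" "f \<in> l2 S"
  shows "l2norm S (p f) \<le> l2norm S f"
  by (rule power2_le_imp_le) (use proj_pythagoras[OF assms] in auto)

text \<open>The rank-one operator built from u and v; when u = v is a unit vector it is the
  projection onto its line.\<close>

definition outer where
  "outer S u v f = (if f \<in> l2 S then (\<lambda>w. ip S f v * u w) else (\<lambda>_. 0))"

lemma bop_outer:
  assumes "u \<in> l2 S" "v \<in> l2 S"
  shows "outer S u v \<in> bounded_ops S"
proof (rule bopI)
  fix f assume f: "f \<in> l2 S"
  have "l2norm S (outer S u v f) \<le> (l2norm S f * l2norm S v) * l2norm S u"
    by (simp add: outer_def f l2norm_scale mult_right_mono ip_le assms)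
  then show "l2norm S (outer S u v f) \<le> (l2norm S v * l2norm S u) * l2norm S f"
    by (simp add: mult_ac)
qed (use assms in \<open>auto simp: outer_def l2_scale l2_lin ip_lin_left ring_distribs mult.assoc\<close>)

lemma comp_outer:
  assumes "A \<in> bounded_ops S" "u \<in> l2 S"
  shows "A \<circ> outer S u v = outer S (A u) v"
  by (auto simp: outer_def bop_scale[OF assms] bop_zero[OF assms(1)] fun_eq_iff)

text \<open>Self-adjointness moves p onto v inside the inner product.\<close>

lemma outer_comp:
  assumes "adj_proj S p" "v \<in> l2 S"
  shows "outer S u v \<circ> p = outer S u (p v)"
proof
  fix f
  show "(outer S u v \<circ> p) f = outer S u (p v) f"
  proof (cases "f \<in> l2 S")
    case True
    then show ?thesis using bop_l2[OF proj_bop[OF assms(1)] True]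
      by (simp add: outer_def proj_adj assms)
  next
    case False
    then show ?thesis using bop_outside[OF proj_bop[OF assms(1)] False]
      by (simp add: outer_def ip_def)
  qed
qed

text \<open>With a the inner product of f and v, the squared norm changes by 4 |a|^2 (|v|^2 - 1),
  which is at most 0. In \<open>phi_outer_nonneg\<close> this norm bound is turned into
  positivity.\<close>

lemma outer_reflection_le:
  assumes "v \<in> l2 S" "l2norm S v \<le> 1" "f \<in> l2 S"
  shows "l2norm S (\<lambda>w. f w - 2 * outer S v v f w) \<le> l2norm S f"
proof (rule power2_le_imp_le)
  let ?a = "ip S f v"
  have eq: "(\<lambda>w. f w - 2 * outer S v v f w) = (\<lambda>w. f w + (-2 * ?a) * v w)"
    by (simp add: outer_def assms mult.assoc)
  have ip: "ip S f (\<lambda>w. (-2 * ?a) * v w) = -2 * complex_of_real ((cmod ?a)\<^sup>2)"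
    using ip_lin_right[of v S v f "-2 * ?a" 0] assms
    by (simp only: complex_norm_square) (simp add: mult_ac)
  have "(cmod ?a)\<^sup>2 * (l2norm S v)\<^sup>2 \<le> (cmod ?a)\<^sup>2 * 1"
    by (intro mult_left_mono) (use assms in \<open>auto simp: power_le_one\<close>)
  then show "(l2norm S (\<lambda>w. f w - 2 * outer S v v f w))\<^sup>2 \<le> (l2norm S f)\<^sup>2"
    unfolding eq l2norm_add_sq[OF assms(3) l2_scale[OF assms(1)]] ip l2norm_scale
    by (simp add: norm_mult power_mult_distrib)
qed simp

section \<open>The orthonormal basis indexed by words\<close>

definition dirac :: "'a list \<Rightarrow> 'a list \<Rightarrow> complex" where
  "dirac w = (\<lambda>v. if v = w then 1 else 0)"

lemma has_sum_single:
  fixes g :: "'a \<Rightarrow> 'b :: {comm_monoid_add, topological_space}"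
  assumes "w \<in> A" "\<And>v. v \<in> A \<Longrightarrow> v \<noteq> w \<Longrightarrow> g v = 0"
  shows "(g has_sum g w) A"
proof -
  have "(g has_sum sum g {w}) {w}" by (rule has_sum_finite) simp
  then show ?thesis
    using has_sum_cong_neutral[of A "{w}" g g "g w"] assms by auto
qed

lemma dirac_l2: "w \<in> coxW S \<Longrightarrow> dirac w \<in> l2 S"
  using has_sum_imp_summable[OF has_sum_single[of w "coxW S" "\<lambda>v. (cmod (dirac w v))\<^sup>2"]]
  by (auto simp: l2_def dirac_def)

lemma dirac_Nil_l2 [simp]: "dirac [] \<in> l2 S"
  by (simp add: dirac_l2)

lemma ip_dirac_right:
  assumes "w \<in> coxW S"
  shows "ip S f (dirac w) = f w"
  using infsumI[OF has_sum_single[of w "coxW S" "\<lambda>v. f v * cnj (dirac w v)"]] assms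
  by (simp add: ip_def dirac_def)

lemma ip_dirac_left: "w \<in> coxW S \<Longrightarrow> ip S (dirac w) f = cnj (f w)"
  by (subst ip_cnj) (simp add: ip_dirac_right)

lemma l2norm_dirac: "w \<in> coxW S \<Longrightarrow> l2norm S (dirac w) = 1"
proof -
  assume w: "w \<in> coxW S"
  have "complex_of_real ((l2norm S (dirac w))\<^sup>2) = complex_of_real 1"
    using ip_self[OF dirac_l2[OF w]] ip_dirac_right[OF w, of "dirac w"] by (simp add: dirac_def)
  then have "(l2norm S (dirac w))\<^sup>2 = 1" by (simp only: of_real_eq_iff)
  then show ?thesis
    using l2norm_nonneg[of S "dirac w"] by (auto simp: power2_eq_1_iff)
qed

section \<open>Commutants\<close>

lemma commutantD:
  assumes "x \<in> commutant S X"
  shows commutant_bop: "x \<in> bounded_ops S"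
    and commutant_commute: "A \<in> X \<Longrightarrow> f \<in> l2 S \<Longrightarrow> A (x f) = x (A f)"
  using assms by (auto simp: commutant_def)

lemma commutantI:
  assumes "x \<in> bounded_ops S" "\<And>A f. A \<in> X \<Longrightarrow> f \<in> l2 S \<Longrightarrow> A (x f) = x (A f)"
  shows "x \<in> commutant S X"
  using assms by (auto simp: commutant_def)

lemma commutant_idop:
  assumes "X \<subseteq> bounded_ops S"
  shows "idop S \<in> commutant S X"
proof (rule commutantI)
  fix A f assume "A \<in> X" "f \<in> l2 S"
  then have "A f \<in> l2 S" using assms bop_l2[of A S f] by blast
  then show "A (idop S f) = idop S (A f)" using \<open>f \<in> l2 S\<close> by simp
qed (rule bop_idop)

lemma commutant_comp:
  assumes "X \<subseteq> bounded_ops S" "x \<in> commutant S X" "y \<in> commutant S X"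
  shows "x \<circ> y \<in> commutant S X"
proof (rule commutantI)
  show "x \<circ> y \<in> bounded_ops S" using assms(2,3)[THEN commutant_bop] by (rule bop_comp)
  fix A f assume A: "A \<in> X" and f: "f \<in> l2 S"
  have "y f \<in> l2 S" using assms(3)[THEN commutant_bop] f by (rule bop_l2)
  then show "A ((x \<circ> y) f) = (x \<circ> y) (A f)"
    using commutant_commute[OF assms(2) A] commutant_commute[OF assms(3) A f] by simp
qed

lemma commutant_oplin:
  assumes "X \<subseteq> bounded_ops S" "x \<in> commutant S X" "y \<in> commutant S X"
  shows "oplin c x d y \<in> commutant S X"
proof (rule commutantI)
  note bop = assms(2,3)[THEN commutant_bop]
  show "oplin c x d y \<in> bounded_ops S" using bop by (rule bop_oplin)
  fix A f assume A: "A \<in> X" and f: "f \<in> l2 S"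
  have "A (\<lambda>w. c * x f w + d * y f w) = (\<lambda>w. c * A (x f) w + d * A (y f) w)"
    using A assms(1) bop[THEN bop_l2, OF f] by (intro bop_lin[of A S]) auto
  then show "A (oplin c x d y f) = oplin c x d y (A f)"
    unfolding oplin_def commutant_commute[OF assms(2) A f] commutant_commute[OF assms(3) A f] .
qed

lemma commutant_commutant_subset:
  "X \<subseteq> bounded_ops S \<Longrightarrow> X \<subseteq> commutant S (commutant S X)"
proof
  fix x assume X: "X \<subseteq> bounded_ops S" and x: "x \<in> X"
  then show "x \<in> commutant S (commutant S X)"
    by (intro commutantI) (auto dest: commutant_commute[OF _ x])
qed

section \<open>Norm-one projections\<close>

text \<open>After squaring, the terms in t^2 cancel and (1 + 2 t) Y^2 \<le> X^2 remains, which fails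
  for large t unless Y = 0.\<close>

lemma eq_0_if_linear_growth:
  fixes X Y :: real
  assumes "Y \<ge> 0" "\<And>t. t \<ge> 0 \<Longrightarrow> (1 + t) * Y \<le> sqrt (X\<^sup>2 + t\<^sup>2 * Y\<^sup>2)"
  shows "Y = 0"
proof (rule ccontr)
  assume "Y \<noteq> 0"
  \<comment> \<open>This value makes X^2 equal to t Y^2, so that the inequality leaves (1 + t) Y^2
    \<le> 0.\<close>
  define t where "t = X\<^sup>2 / Y\<^sup>2"
  have t: "t \<ge> 0" by (simp add: t_def)
  have "((1 + t) * Y)\<^sup>2 \<le> X\<^sup>2 + t\<^sup>2 * Y\<^sup>2"
    using power_mono[OF assms(2)[OF t], of 2] assms(1) t by simp
  moreover have "((1 + t) * Y)\<^sup>2 = (1 + t) * Y\<^sup>2 + t * Y\<^sup>2 + t\<^sup>2 * Y\<^sup>2"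
    by (simp add: power2_eq_square distrib_left distrib_right)
  moreover have "X\<^sup>2 = t * Y\<^sup>2" using \<open>Y \<noteq> 0\<close> by (simp add: t_def)
  ultimately have "(1 + t) * Y\<^sup>2 \<le> 0" by linarith
  then show False using t \<open>Y \<noteq> 0\<close> by (simp add: mult_le_0_iff)
qed

text \<open>Collects the closure properties of M that Tomiyama's argument uses.
  \<open>conditional_expectation_vNa\<close> supplies them for the Hecke algebra from its being a
  commutant.\<close>

locale conditional_expectation =
  fixes S :: "'a set" and M and E
  assumes M_bop: "x \<in> M \<Longrightarrow> x \<in> bounded_ops S"
    and M_id: "idop S \<in> M"
    and M_comp: "x \<in> M \<Longrightarrow> y \<in> M \<Longrightarrow> x \<circ> y \<in> M"
    and M_oplin: "x \<in> M \<Longrightarrow> y \<in> M \<Longrightarrow> oplin c x d y \<in> M"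
    and ce: "cond_exp S M E"
begin

section \<open>Module property of norm-one projections\<close>

lemma E_in: "x \<in> bounded_ops S \<Longrightarrow> E x \<in> M"
  and E_fix: "x \<in> M \<Longrightarrow> E x = x"
  and E_norm: "x \<in> bounded_ops S \<Longrightarrow> op_norm S (E x) \<le> op_norm S x"
  using ce unfolding cond_exp_def by blast+

lemma E_oplin: "x \<in> bounded_ops S \<Longrightarrow> y \<in> bounded_ops S \<Longrightarrow>
    E (oplin c x d y) = oplin c (E x) d (E y)"
  using ce unfolding cond_exp_def oplin_def by blast

lemma E_bop: "x \<in> bounded_ops S \<Longrightarrow> E x \<in> bounded_ops S"
  by (rule M_bop[OF E_in])

lemma M_compl: "p \<in> M \<Longrightarrow> compl_op S p \<in> M"
  unfolding compl_op_def by (intro M_oplin M_id)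

text \<open>Let y = (1 - p) E(p x), an element of M and hence fixed by \<open>E\<close>. Then (1 -
  p) E(p x + t y) = (1 + t) y, so (1 + t) |y| is at most the norm of p x + t y. As p x and y have
  orthogonal ranges, the square of that norm is at most |p x|^2 + t^2 |y|^2, and
  \<open>eq_0_if_linear_growth\<close> gives y = 0.\<close>

lemma E_left_aux:
  assumes p: "p \<in> M" "adj_proj S p" and x: "x \<in> bounded_ops S"
  shows "compl_op S p \<circ> E (p \<circ> x) = (\<lambda>_ _. 0)"
proof -
  let ?p' = "compl_op S p"
  have px: "p \<circ> x \<in> bounded_ops S" by (rule bop_comp[OF M_bop[OF p(1)] x])
  have p': "?p' \<in> M" "adj_proj S ?p'" by (intro p M_compl adj_proj_compl)+
  define y where "y = ?p' \<circ> E (p \<circ> x)"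
  have yM: "y \<in> M" unfolding y_def by (intro p' px M_comp E_in)
  have y: "y \<in> bounded_ops S" using yM by (rule M_bop)
  have p'y: "?p' (y f) = y f" if "f \<in> l2 S" for f
    using that by (simp add: y_def proj_idem[OF p'(2)] bop_l2[OF E_bop[OF px]])
  have "op_norm S y = 0"
  proof (rule eq_0_if_linear_growth)
    fix t :: real assume t: "t \<ge> 0"
    let ?u = "oplin 1 (p \<circ> x) (complex_of_real t) y"
    have u: "?u \<in> bounded_ops S" by (intro px y bop_oplin)
    have Eu: "E ?u = oplin 1 (E (p \<circ> x)) (complex_of_real t) y"
      by (simp add: E_oplin px y E_fix yM)
    have p'Eu: "?p' (E ?u f) = (\<lambda>w. complex_of_real (1 + t) * y f w)" if f: "f \<in> l2 S" for f
    proof -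
      have "?p' (E ?u f) = (\<lambda>w. 1 * ?p' (E (p \<circ> x) f) w + complex_of_real t * ?p' (y f) w)"
        unfolding Eu unfolding oplin_def by (rule bop_lin[OF M_bop[OF p'(1)] bop_l2[OF E_bop[OF px] f] bop_l2[OF y f]])
      then show ?thesis unfolding p'y[OF f] by (simp add: y_def algebra_simps)
    qed
    have "op_norm S y \<le> op_norm S ?u / (1 + t)"
    proof (rule op_norm_le)
      fix f assume f: "f \<in> l2 S"
      have "(1 + t) * l2norm S (y f) = l2norm S (?p' (E ?u f))"
        using t unfolding p'Eu[OF f] l2norm_scale norm_of_real by simp
      also have "\<dots> \<le> l2norm S (E ?u f)"
        by (rule proj_norm_le[OF p'(2) bop_l2[OF E_bop[OF u] f]])
      also have "\<dots> \<le> op_norm S (E ?u) * l2norm S f"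
        by (rule op_norm_bound[OF E_bop[OF u] f])
      also have "\<dots> \<le> op_norm S ?u * l2norm S f"
        by (intro u mult_right_mono E_norm) auto
      finally show "l2norm S (y f) \<le> op_norm S ?u / (1 + t) * l2norm S f"
        using t by (simp add: field_simps)
    qed (use t op_norm_nonneg[OF u] in auto)
    then have "(1 + t) * op_norm S y \<le> op_norm S ?u"
      using t by (simp add: field_simps)
    also have "\<dots> \<le> sqrt ((op_norm S (p \<circ> x))\<^sup>2 + t\<^sup>2 * (op_norm S y)\<^sup>2)"
    proof (rule op_norm_le)
      fix f assume f: "f \<in> l2 S"
      let ?X = "op_norm S (p \<circ> x)" and ?Y = "op_norm S y"
      have l2: "x f \<in> l2 S" "p (x f) \<in> l2 S" "y f \<in> l2 S" "?u f \<in> l2 S"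
        by (rule bop_l2[OF x f] bop_l2[OF M_bop[OF p(1)] bop_l2[OF x f]] bop_l2[OF y f] bop_l2[OF u f])+
      have 1: "p (y f) = (\<lambda>_. 0)"
        using proj_compl_eq_0[OF p(2) l2(3)] p'y[OF f] by simp
      have "?p' (p (x f)) = (\<lambda>_. 0)"
        by (simp add: compl_op_apply l2 proj_idem[OF p(2)])
      then have 2: "?p' (?u f) = (\<lambda>w. complex_of_real t * y f w)"
        using bop_lin[OF M_bop[OF p'(1)] l2(2) l2(3), of 1 t] p'y[OF f]
        by (simp add: oplin_def)
      have 3: "p (?u f) = p (x f)"
        using bop_lin[OF M_bop[OF p(1)] l2(2) l2(3), of 1 t] 1 proj_idem[OF p(2) l2(1)]
        by (simp add: oplin_def)
      have "(l2norm S (?u f))\<^sup>2 = (l2norm S ((p \<circ> x) f))\<^sup>2 + (t * l2norm S (y f))\<^sup>2"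
        unfolding proj_pythagoras[OF p(2) l2(4)] 2 3 l2norm_scale using t by simp
      also have "\<dots> \<le> (?X * l2norm S f)\<^sup>2 + (t * (?Y * l2norm S f))\<^sup>2"
        by (intro px y f t add_mono power_mono mult_left_mono op_norm_bound mult_nonneg_nonneg) auto
      also have "\<dots> = (sqrt (?X\<^sup>2 + t\<^sup>2 * ?Y\<^sup>2) * l2norm S f)\<^sup>2"
        by (simp add: power_mult_distrib algebra_simps)
      finally show "l2norm S (?u f) \<le> sqrt (?X\<^sup>2 + t\<^sup>2 * ?Y\<^sup>2) * l2norm S f"
        by (rule power2_le_imp_le) auto
    qed auto
    finally show "(1 + t) * op_norm S y \<le> sqrt ((op_norm S (p \<circ> x))\<^sup>2 + t\<^sup>2 * (op_norm S y)\<^sup>2)" .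
  qed (rule op_norm_nonneg[OF y])
  then show ?thesis using op_norm_eq_0[OF y] by (auto simp: y_def fun_eq_iff)
qed

text \<open>Proved separately from \<open>E_left_aux\<close> because compatibility of
  \<open>E\<close> with adjoints has not been established. Here x p and y = E(x p) (1 - p) depend on
  the two orthogonal components of the argument, so the norm of x p + t y is bounded by
  Cauchy-Schwarz in the plane.\<close>

lemma E_right_aux:
  assumes p: "p \<in> M" "adj_proj S p" and x: "x \<in> bounded_ops S"
  shows "E (x \<circ> p) \<circ> compl_op S p = (\<lambda>_ _. 0)"
proof -
  let ?p' = "compl_op S p"
  have px: "x \<circ> p \<in> bounded_ops S" by (rule bop_comp[OF x M_bop[OF p(1)]])
  have p': "?p' \<in> M" "adj_proj S ?p'" by (intro p M_compl adj_proj_compl)+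
  define y where "y = E (x \<circ> p) \<circ> ?p'"
  have yM: "y \<in> M" unfolding y_def by (intro p' px M_comp E_in)
  have y: "y \<in> bounded_ops S" using yM by (rule M_bop)
  have yp': "y (?p' f) = y f" if "f \<in> l2 S" for f
    using that by (simp add: y_def proj_idem[OF p'(2)])
  have "op_norm S y = 0"
  proof (rule eq_0_if_linear_growth)
    fix t :: real assume t: "t \<ge> 0"
    let ?u = "oplin 1 (x \<circ> p) (complex_of_real t) y"
    have u: "?u \<in> bounded_ops S" by (intro px y bop_oplin)
    have Eu: "E ?u = oplin 1 (E (x \<circ> p)) (complex_of_real t) y"
      by (simp add: E_oplin px y E_fix yM)
    have p'Eu: "E ?u (?p' f) = (\<lambda>w. complex_of_real (1 + t) * y f w)" if f: "f \<in> l2 S" for f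
      unfolding Eu unfolding oplin_def yp'[OF f] by (simp add: y_def algebra_simps)
    have "op_norm S y \<le> op_norm S ?u / (1 + t)"
    proof (rule op_norm_le)
      fix f assume f: "f \<in> l2 S"
      have p'f: "?p' f \<in> l2 S" by (rule bop_l2[OF M_bop[OF p'(1)] f])
      have "(1 + t) * l2norm S (y f) = l2norm S (E ?u (?p' f))"
        using t unfolding p'Eu[OF f] l2norm_scale norm_of_real by simp
      also have "\<dots> \<le> op_norm S (E ?u) * l2norm S (?p' f)"
        by (rule op_norm_bound[OF E_bop[OF u] p'f])
      also have "\<dots> \<le> op_norm S ?u * l2norm S f"
        by (intro u p' f mult_mono E_norm proj_norm_le op_norm_nonneg) auto
      finally show "l2norm S (y f) \<le> op_norm S ?u / (1 + t) * l2norm S f"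
        using t by (simp add: field_simps)
    qed (use t op_norm_nonneg[OF u] in auto)
    then have "(1 + t) * op_norm S y \<le> op_norm S ?u"
      using t by (simp add: field_simps)
    also have "\<dots> \<le> sqrt ((op_norm S (x \<circ> p))\<^sup>2 + t\<^sup>2 * (op_norm S y)\<^sup>2)"
    proof (rule op_norm_le)
      fix f assume f: "f \<in> l2 S"
      let ?X = "op_norm S (x \<circ> p)" and ?Y = "op_norm S y"
      let ?a = "l2norm S (p f)" and ?b = "l2norm S (?p' f)"
      have l2: "p f \<in> l2 S" "?p' f \<in> l2 S" "(x \<circ> p) f \<in> l2 S" "y f \<in> l2 S"
        by (rule bop_l2[OF M_bop[OF p(1)] f] bop_l2[OF M_bop[OF p'(1)] f] bop_l2[OF px f] bop_l2[OF y f])+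
      have 1: "l2norm S ((x \<circ> p) f) \<le> ?X * ?a"
        using op_norm_bound[OF px l2(1)] by (simp add: proj_idem[OF p(2)] f)
      have 2: "l2norm S (y f) \<le> ?Y * ?b"
        using op_norm_bound[OF y l2(2)] by (simp add: yp' f)
      have "l2norm S (?u f) \<le> l2norm S ((x \<circ> p) f) + t * l2norm S (y f)"
        using l2norm_triangle[OF l2(3) l2_scale[OF l2(4), of t]] t
        by (simp add: oplin_def l2norm_scale)
      also have "\<dots> \<le> ?X * ?a + (t * ?Y) * ?b"
        using 1 mult_left_mono[OF 2 t] by (simp add: mult.assoc)
      also have "\<dots> \<le> sqrt (?X\<^sup>2 + (t * ?Y)\<^sup>2) * sqrt (?a\<^sup>2 + ?b\<^sup>2)"
        unfolding real_sqrt_mult[symmetric]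
      proof (rule real_le_rsqrt)
        \<comment> \<open>This square is the gap in the two-dimensional Cauchy-Schwarz
          inequality.\<close>
        have "0 \<le> (?X * ?b - t * ?Y * ?a)\<^sup>2" by simp
        then show "(?X * ?a + t * ?Y * ?b)\<^sup>2 \<le> (?X\<^sup>2 + (t * ?Y)\<^sup>2) * (?a\<^sup>2 + ?b\<^sup>2)"
          by (simp add: power2_eq_square algebra_simps)
      qed
      also have "sqrt (?a\<^sup>2 + ?b\<^sup>2) = l2norm S f"
        by (simp flip: proj_pythagoras[OF p(2) f])
      finally show "l2norm S (?u f) \<le> sqrt (?X\<^sup>2 + t\<^sup>2 * ?Y\<^sup>2) * l2norm S f"
        by (simp only: power_mult_distrib)
    qed auto
    finally show "(1 + t) * op_norm S y \<le> sqrt ((op_norm S (x \<circ> p))\<^sup>2 + t\<^sup>2 * (op_norm S y)\<^sup>2)" .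
  qed (rule op_norm_nonneg[OF y])
  then show ?thesis using op_norm_eq_0[OF y] by (auto simp: y_def fun_eq_iff)
qed

text \<open>\<open>E_left_aux\<close> for p and for 1 - p gives p E(p x) = E(p x) and p E((1 - p) x)
  = 0; applying p to E(x) = E(p x) + E((1 - p) x) finishes.\<close>

lemma E_left_mult:
  assumes p: "p \<in> M" "adj_proj S p" and x: "x \<in> bounded_ops S"
  shows "E (p \<circ> x) = p \<circ> E x"
proof (rule bop_ext)
  let ?p' = "compl_op S p"
  have p': "?p' \<in> M" "adj_proj S ?p'" by (intro p M_compl adj_proj_compl)+
  have px: "p \<circ> x \<in> bounded_ops S" "?p' \<circ> x \<in> bounded_ops S"
    by (intro p p' x bop_comp M_bop)+
  show "E (p \<circ> x) \<in> bounded_ops S" "p \<circ> E x \<in> bounded_ops S"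
    by (intro px p x E_bop bop_comp M_bop)+
  fix f assume f: "f \<in> l2 S"
  have l2: "E (p \<circ> x) f \<in> l2 S" "E (?p' \<circ> x) f \<in> l2 S"
    by (rule bop_l2[OF E_bop[OF px(1)] f] bop_l2[OF E_bop[OF px(2)] f])+
  have "?p' (E (p \<circ> x) f) = (\<lambda>_. 0)"
    using fun_cong[OF E_left_aux[OF p x], of f] by simp
  then have 1: "p (E (p \<circ> x) f) = E (p \<circ> x) f"
    by (simp add: compl_op_apply l2 fun_eq_iff)
  have 2: "p (E (?p' \<circ> x) f) = (\<lambda>_. 0)"
    using fun_cong[OF E_left_aux[OF p' x], of f] by (simp add: compl_op_compl_op M_bop p)
  have "x = oplin 1 (p \<circ> x) 1 (?p' \<circ> x)"
    by (rule bop_ext[OF x bop_oplin[OF px]]) (simp add: oplin_def compl_op_apply bop_l2[OF x])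
  then have "E x f = (\<lambda>w. E (p \<circ> x) f w + E (?p' \<circ> x) f w)"
    using E_oplin[OF px, of 1 1] by (simp add: oplin_def)
  then show "E (p \<circ> x) f = (p \<circ> E x) f"
    using 1 2 by (simp add: bop_add[OF M_bop[OF p(1)] l2])
qed

lemma E_right_mult:
  assumes p: "p \<in> M" "adj_proj S p" and x: "x \<in> bounded_ops S"
  shows "E (x \<circ> p) = E x \<circ> p"
proof (rule bop_ext)
  let ?p' = "compl_op S p"
  have p': "?p' \<in> M" "adj_proj S ?p'" by (intro p M_compl adj_proj_compl)+
  have px: "x \<circ> p \<in> bounded_ops S" "x \<circ> ?p' \<in> bounded_ops S"
    by (intro p p' x bop_comp M_bop)+
  show "E (x \<circ> p) \<in> bounded_ops S" "E x \<circ> p \<in> bounded_ops S"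
    by (intro px p x E_bop bop_comp M_bop)+
  fix f assume f: "f \<in> l2 S"
  have pf: "p f \<in> l2 S" by (rule bop_l2[OF M_bop[OF p(1)] f])
  have "E (x \<circ> p) (?p' f) = (\<lambda>_. 0)"
    using fun_cong[OF E_right_aux[OF p x], of f] by simp
  then have 1: "E (x \<circ> p) (p f) = E (x \<circ> p) f"
    by (simp add: compl_op_apply f pf fun_eq_iff bop_diff[OF E_bop[OF px(1)]])
  have 2: "E (x \<circ> ?p') (p f) = (\<lambda>_. 0)"
    using fun_cong[OF E_right_aux[OF p' x], of f] by (simp add: compl_op_compl_op M_bop p)
  have "x = oplin 1 (x \<circ> p) 1 (x \<circ> ?p')"
    by (rule bop_ext[OF x bop_oplin[OF px]])
      (simp add: oplin_def compl_op_apply bop_diff[OF x] bop_l2[OF M_bop[OF p(1)]])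
  then have "E x (p f) = (\<lambda>w. E (x \<circ> p) (p f) w + E (x \<circ> ?p') (p f) w)"
    using E_oplin[OF px, of 1 1] by (simp add: oplin_def)
  then show "E (x \<circ> p) f = (E x \<circ> p) f"
    using 1 2 by simp
qed

section \<open>The state given by the trace after the expectation, read off as the coefficient at
  the empty word\<close>

definition phi :: "(('a list \<Rightarrow> complex) \<Rightarrow> ('a list \<Rightarrow> complex)) \<Rightarrow> complex" where
  "phi x = E x (dirac []) []"

lemma phi_oplin: "x \<in> bounded_ops S \<Longrightarrow> y \<in> bounded_ops S \<Longrightarrow>
    phi (oplin c x d y) = c * phi x + d * phi y"
  by (simp add: phi_def E_oplin) (simp add: oplin_def)

lemma phi_id: "phi (idop S) = 1"
  by (simp add: phi_def E_fix M_id) (simp add: dirac_def)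

lemma phi_le:
  assumes "x \<in> bounded_ops S"
  shows "cmod (phi x) \<le> op_norm S x"
proof -
  have "cmod (phi x) \<le> l2norm S (E x (dirac []))"
    unfolding phi_def by (intro cmod_le_l2norm bop_l2[OF E_bop[OF assms] dirac_Nil_l2]) simp
  also have "\<dots> \<le> op_norm S (E x) * l2norm S (dirac [])"
    by (rule op_norm_bound[OF E_bop[OF assms] dirac_Nil_l2])
  finally show ?thesis using E_norm[OF assms] by (simp add: l2norm_dirac)
qed

text \<open>A contractive unital functional is positive: the operator 1 - 2
  \<open>outer S v v\<close> is a contraction, so the real part of its value 1 - 2
  \<open>phi (outer S v v)\<close> is at most 1.\<close>

lemma phi_outer_nonneg:
  assumes "v \<in> l2 S" "l2norm S v \<le> 1"
  shows "0 \<le> Re (phi (outer S v v))"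
proof -
  let ?r = "oplin 1 (idop S) (-2) (outer S v v)"
  have r: "?r \<in> bounded_ops S" by (intro assms bop_oplin bop_idop bop_outer)
  have "op_norm S ?r \<le> 1"
    by (rule op_norm_le) (use outer_reflection_le[OF assms] in \<open>auto simp: oplin_def\<close>)
  then have "cmod (phi ?r) \<le> 1" using phi_le[OF r] by simp
  then have "Re (phi ?r) \<le> 1" using complex_Re_le_cmod order.trans by blast
  moreover have "phi ?r = 1 - 2 * phi (outer S v v)"
    by (simp add: phi_oplin bop_idop bop_outer assms phi_id)
  ultimately show ?thesis by simp
qed

text \<open>With y = \<open>E x\<close>, the module property turns the two compressions into p y p
  and (1 - p) y (1 - p). Moving one factor around under the trace gives y p and y (1 - p), which add
  up to y. The assumption \<open>tr\<close> asks for the trace property against p alone, which is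
  directly checkable for the projections used later.\<close>

lemma phi_compression:
  assumes p: "p \<in> M" "adj_proj S p" and x: "x \<in> bounded_ops S"
    and tr: "\<And>y. y \<in> M \<Longrightarrow> p (y (dirac [])) [] = y (p (dirac [])) []"
  shows "phi x = phi (p \<circ> x \<circ> p) + phi (compl_op S p \<circ> x \<circ> compl_op S p)"
proof -
  let ?p' = "compl_op S p" and ?d = "dirac [] :: 'a list \<Rightarrow> complex" and ?y = "E x"
  have p': "?p' \<in> M" "adj_proj S ?p'" by (intro p M_compl adj_proj_compl)+
  have E: "E (p \<circ> x \<circ> p) = p \<circ> ?y \<circ> p" "E (?p' \<circ> x \<circ> ?p') = ?p' \<circ> ?y \<circ> ?p'"
    by (simp_all add: E_left_mult E_right_mult p p' x bop_comp M_bop)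
  have y: "?y \<in> M" by (intro x E_in)
  have l2: "p ?d \<in> l2 S" "?p' ?d \<in> l2 S" by (rule bop_l2[OF M_bop[OF p(1)] dirac_Nil_l2] bop_l2[OF M_bop[OF p'(1)] dirac_Nil_l2])+
  have 1: "phi (p \<circ> x \<circ> p) = ?y (p ?d) []"
    using tr[OF M_comp[OF y p(1)]] by (simp add: phi_def E proj_idem[OF p(2)])
  \<comment> \<open>The cross term p y (1 - p) has trace zero: moving p to the right produces (1 -
    p) p = 0.\<close>
  have "p (?y (?p' ?d)) [] = ?y (?p' (p ?d)) []"
    using tr[OF M_comp[OF y p'(1)]] by simp
  also have "?p' (p ?d) = (\<lambda>_. 0)"
    by (simp add: compl_op_apply l2 proj_idem[OF p(2)])
  finally have "p (?y (?p' ?d)) [] = 0"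
    by (simp add: bop_zero[OF M_bop[OF y]])
  then have 2: "phi (?p' \<circ> x \<circ> ?p') = ?y (?p' ?d) []"
    by (simp add: phi_def E compl_op_apply[OF bop_l2[OF M_bop[OF y] l2(2)]])
  have "?y ?d = ?y (\<lambda>w. p ?d w + ?p' ?d w)"
    by (simp add: compl_op_apply)
  also have "\<dots> = (\<lambda>w. ?y (p ?d) w + ?y (?p' ?d) w)"
    by (rule bop_add[OF M_bop[OF y] l2])
  finally show ?thesis by (simp add: 1 2) (simp add: phi_def)
qed

end

section \<open>The generators\<close>

definition shift_op where
  "shift_op S s f = (if f \<in> l2 S then (\<lambda>v. if v \<in> coxW S then f (lmul s v) else 0) else (\<lambda>_. 0))"

definition start_op where
  "start_op S s f = (if f \<in> l2 S then (\<lambda>v. if starts s v then f v else 0) else (\<lambda>_. 0))"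

text \<open>Reversing a word is inversion in the group, since the generators are involutions;
  conjugation by this operator therefore exchanges left and right multiplication.\<close>

definition flip_op where
  "flip_op S f = (if f \<in> l2 S then (\<lambda>v. f (rev v)) else (\<lambda>_. 0))"

lemma reindex_l2:
  assumes "bij_betw h (coxW S) (coxW S)" "f \<in> l2 S"
    and g: "\<And>v. v \<in> coxW S \<Longrightarrow> g v = f (h v)" "\<And>v. v \<notin> coxW S \<Longrightarrow> g v = 0"
  shows "g \<in> l2 S" "l2norm S g = l2norm S f"
proof -
  have "(\<lambda>v. (cmod (f (h v)))\<^sup>2) summable_on coxW S"
    using summable_on_reindex_bij_betw[OF assms(1), of "\<lambda>v. (cmod (f v))\<^sup>2"] l2_summable[OF assms(2)]
    by simp
  then show "g \<in> l2 S"
    by (rule l2_comparison) (use g in auto)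
  have "(\<Sum>\<^sub>\<infinity>w\<in>coxW S. (cmod (g w))\<^sup>2) = (\<Sum>\<^sub>\<infinity>w\<in>coxW S. (cmod (f (h w)))\<^sup>2)"
    by (rule infsum_cong) (simp add: g)
  also have "\<dots> = (\<Sum>\<^sub>\<infinity>w\<in>coxW S. (cmod (f w))\<^sup>2)"
    by (rule infsum_reindex_bij_betw[OF assms(1)])
  finally show "l2norm S g = l2norm S f" by (simp add: l2norm_def)
qed

lemma bop_shift:
  assumes "s \<in> S"
  shows "shift_op S s \<in> bounded_ops S"
proof (rule bopI[where C = 1])
  fix f assume f: "f \<in> l2 S"
  show "shift_op S s f \<in> l2 S" "l2norm S (shift_op S s f) \<le> 1 * l2norm S f"
    using reindex_l2[OF bij_betw_lmul[OF assms] f, of "shift_op S s f"] f by (auto simp: shift_op_def)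
qed (auto simp: shift_op_def l2_lin)

lemma bop_flip: "flip_op S \<in> bounded_ops S"
proof (rule bopI[where C = 1])
  fix f assume f: "f \<in> l2 S"
  show "flip_op S f \<in> l2 S" "l2norm S (flip_op S f) \<le> 1 * l2norm S f"
    using reindex_l2[OF bij_betw_rev_coxW f, of "flip_op S f"] f l2_outside[OF f]
    by (auto simp: flip_op_def)
qed (auto simp: flip_op_def l2_lin)

lemma bop_start: "start_op S s \<in> bounded_ops S"
proof (rule bopI[where C = 1])
  fix f assume f: "f \<in> l2 S"
  have le: "(cmod (start_op S s f w))\<^sup>2 \<le> (cmod (f w))\<^sup>2" for w
    by (simp add: start_op_def)
  show l2: "start_op S s f \<in> l2 S"
    by (rule l2_comparison[OF l2_summable[OF f] le]) (simp add: start_op_def f l2_outside[OF f])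
  have "(l2norm S (start_op S s f))\<^sup>2 \<le> (l2norm S f)\<^sup>2"
    unfolding l2norm_sq by (rule infsum_mono[OF l2_summable[OF l2] l2_summable[OF f] le])
  then show "l2norm S (start_op S s f) \<le> 1 * l2norm S f"
    unfolding mult_1 by (rule power2_le_imp_le) simp
qed (auto simp: start_op_def l2_lin)

lemmas start_op_l2 = bop_l2[OF bop_start]

text \<open>Splits \<open>T\<^sub>s\<close> into a permutation of the basis and a real multiple of a
  diagonal projection, from which boundedness and self-adjointness are read off.\<close>

lemma hecke_gen_eq: "hecke_gen S q s = oplin 1 (shift_op S s) (hecke_p q) (start_op S s)"
  unfolding hecke_gen_def shift_op_def start_op_def oplin_def length_lmul_less_iff
  by (auto simp: fun_eq_iff l2_outside)

lemma bop_hecke_gen: "s \<in> S \<Longrightarrow> hecke_gen S q s \<in> bounded_ops S"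
  unfolding hecke_gen_eq by (intro bop_oplin bop_shift bop_start)

lemmas hecke_gen_l2 = bop_l2[OF bop_hecke_gen]

lemma hecke_gen_apply:
  "f \<in> l2 S \<Longrightarrow> v \<in> coxW S \<Longrightarrow>
    hecke_gen S q s f v = f (lmul s v) + (if starts s v then complex_of_real (hecke_p q) * f v else 0)"
  by (simp add: hecke_gen_def length_lmul_less_iff)

lemma ip_shift:
  assumes "s \<in> S" "f \<in> l2 S" "g \<in> l2 S"
  shows "ip S (shift_op S s f) g = ip S f (shift_op S s g)"
proof -
  have "ip S (shift_op S s f) g = (\<Sum>\<^sub>\<infinity>v\<in>coxW S. f (lmul s v) * cnj (g (lmul s (lmul s v))))"
    unfolding ip_def by (rule infsum_cong) (simp add: shift_op_def assms lmul_lmul)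
  also have "\<dots> = (\<Sum>\<^sub>\<infinity>v\<in>coxW S. f v * cnj (g (lmul s v)))"
    by (rule infsum_reindex_bij_betw[OF bij_betw_lmul[OF assms(1)]])
  also have "\<dots> = ip S f (shift_op S s g)"
    unfolding ip_def by (rule infsum_cong) (simp add: shift_op_def assms)
  finally show ?thesis .
qed

lemma ip_start:
  assumes "f \<in> l2 S" "g \<in> l2 S"
  shows "ip S (start_op S s f) g = ip S f (start_op S s g)"
  unfolding ip_def by (rule infsum_cong) (simp add: start_op_def assms)

lemma ip_hecke_gen:
  assumes "s \<in> S" "f \<in> l2 S" "g \<in> l2 S"
  shows "ip S (hecke_gen S q s f) g = ip S f (hecke_gen S q s g)"
  unfolding hecke_gen_eq oplin_def
  by (simp only: ip_lin_left ip_lin_right bop_l2[OF bop_shift] start_op_l2 assms)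
    (simp add: ip_shift ip_start assms)

text \<open>The spectral projection of \<open>T\<^sub>s\<close> for the eigenvalue \<open>sqrt q\<close>; the other
  eigenvalue is \<open>- 1 / sqrt q\<close>.\<close>
definition hecke_proj where
  "hecke_proj S q s = oplin (complex_of_real (1 / (1 + q))) (idop S)
     (complex_of_real (sqrt q / (1 + q))) (hecke_gen S q s)"

text \<open>For w not starting with s, the span of w and sw is invariant, and the operator acts
  there by 1 / (1 + q) times the matrix with rows (1, sqrt q) and (sqrt q, q). The entry q is 1 +
  sqrt q * \<open>hecke_p q\<close>.\<close>

lemma hecke_proj_apply:
  assumes "q > 0" "f \<in> l2 S" "v \<in> coxW S"
  shows "hecke_proj S q s f v = ((if starts s v then complex_of_real q else 1) * f v
     + complex_of_real (sqrt q) * f (lmul s v)) / complex_of_real (1 + q)"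
proof -
  have "sqrt q * hecke_p q = q - 1"
    using assms by (simp add: hecke_p_def)
  then have "complex_of_real (sqrt q) * (complex_of_real (hecke_p q) * z) = (complex_of_real q - 1) * z" for z
    by (simp flip: of_real_mult mult.assoc)
  then show ?thesis
    by (auto simp: hecke_proj_def oplin_def hecke_gen_apply assms add_divide_distrib ring_distribs
        diff_divide_distrib)
qed

lemma bop_hecke_proj: "s \<in> S \<Longrightarrow> hecke_proj S q s \<in> bounded_ops S"
  unfolding hecke_proj_def by (intro bop_oplin bop_idop bop_hecke_gen)

lemmas hecke_proj_l2 = bop_l2[OF bop_hecke_proj]

text \<open>Replaces 1 / (1 + q) and sqrt q by complex numbers k and r tied together by one
  polynomial relation, so that the later matrix identities become goals for
  \<open>algebra\<close>.\<close>

lemma hecke_proj_coeffs: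
  assumes "q > 0"
  obtains k r where "k * (1 + r * r) = 1" "complex_of_real (1 / (1 + q)) = k"
    "complex_of_real (q / (1 + q)) = k * (r * r)"
    "\<And>s f v. f \<in> l2 S \<Longrightarrow> v \<in> coxW S \<Longrightarrow> starts s v \<Longrightarrow>
        hecke_proj S q s f v = k * (r * r * f v + r * f (lmul s v))"
    "\<And>s f v. f \<in> l2 S \<Longrightarrow> v \<in> coxW S \<Longrightarrow> \<not> starts s v \<Longrightarrow>
        hecke_proj S q s f v = k * (f v + r * f (lmul s v))"
proof
  let ?k = "complex_of_real (1 / (1 + q))" and ?r = "complex_of_real (sqrt q)"
  have r: "?r * ?r = complex_of_real q"
    using assms by (simp flip: of_real_mult)
  have "?k * (1 + complex_of_real q) = complex_of_real (1 / (1 + q) * (1 + q))"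
    by (simp only: of_real_mult of_real_add of_real_1)
  also have "1 / (1 + q) * (1 + q) = 1"
    using assms by simp
  finally show "?k * (1 + ?r * ?r) = 1" by (simp only: r of_real_1)
  show "complex_of_real (q / (1 + q)) = ?k * (?r * ?r)"
    unfolding r by simp
  fix s f v assume fv: "f \<in> l2 S" "v \<in> coxW S"
  show "hecke_proj S q s f v = ?k * (?r * ?r * f v + ?r * f (lmul s v))" if "starts s v"
    unfolding r using that by (simp add: hecke_proj_apply[OF assms fv])
  show "hecke_proj S q s f v = ?k * (f v + ?r * f (lmul s v))" if "\<not> starts s v"
    using that by (simp add: hecke_proj_apply[OF assms fv])
qed auto

lemma hecke_proj_idem:
  assumes "s \<in> S" "q > 0" "f \<in> l2 S"
  shows "hecke_proj S q s (hecke_proj S q s f) = hecke_proj S q s f"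
proof
  fix v
  have l2: "hecke_proj S q s f \<in> l2 S" "hecke_proj S q s (hecke_proj S q s f) \<in> l2 S"
    by (intro assms hecke_proj_l2)+
  show "hecke_proj S q s (hecke_proj S q s f) v = hecke_proj S q s f v"
  proof (cases "v \<in> coxW S")
    case True
    obtain k r where k: "k * (1 + r * r) = 1" and ap:
      "\<And>f v. f \<in> l2 S \<Longrightarrow> v \<in> coxW S \<Longrightarrow> starts s v \<Longrightarrow>
        hecke_proj S q s f v = k * (r * r * f v + r * f (lmul s v))"
      "\<And>f v. f \<in> l2 S \<Longrightarrow> v \<in> coxW S \<Longrightarrow> \<not> starts s v \<Longrightarrow>
        hecke_proj S q s f v = k * (f v + r * f (lmul s v))"
      using hecke_proj_coeffs[OF assms(2), of S] by metis
    have L: "lmul s v \<in> coxW S" by (rule lmul_in_coxW[OF assms(1) True])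
    let ?g = "hecke_proj S q s f"
    show ?thesis
    proof (cases "starts s v")
      case st: True
      have "?g v = k * (r * r * f v + r * f (lmul s v))" "?g (lmul s v) = k * (f (lmul s v) + r * f v)"
        "hecke_proj S q s ?g v = k * (r * r * ?g v + r * ?g (lmul s v))"
        using ap(1)[OF assms(3) True st] ap(2)[OF assms(3) L] ap(1)[OF l2(1) True st] st True
        by (auto simp: starts_lmul lmul_lmul)
      then show ?thesis using k by algebra
    next
      case st: False
      have "?g v = k * (f v + r * f (lmul s v))" "?g (lmul s v) = k * (r * r * f (lmul s v) + r * f v)"
        "hecke_proj S q s ?g v = k * (?g v + r * ?g (lmul s v))"
        using ap(2)[OF assms(3) True st] ap(1)[OF assms(3) L] ap(2)[OF l2(1) True st] st True
        by (auto simp: starts_lmul lmul_lmul)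
      then show ?thesis using k by algebra
    qed
  qed (use l2 in \<open>simp add: l2_outside\<close>)
qed

lemma adj_proj_hecke_proj:
  assumes "s \<in> S" "q > 0"
  shows "adj_proj S (hecke_proj S q s)"
  unfolding adj_proj_def
proof (intro conjI ballI)
  fix f g assume fg: "f \<in> l2 S" "g \<in> l2 S"
  show "ip S (hecke_proj S q s f) g = ip S f (hecke_proj S q s g)"
    unfolding hecke_proj_def oplin_def
    by (simp only: ip_lin_left ip_lin_right bop_l2[OF bop_hecke_gen] idop_apply assms fg)
      (simp add: ip_hecke_gen assms fg)
qed (use assms in \<open>auto simp: hecke_proj_idem bop_hecke_proj\<close>)

text \<open>On each pair w, sw the projection has rank one, along the vector (1, sqrt q); the word
  starting with s carries the fraction q / (1 + q) of its squared length. The right-hand side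
  encodes a scalar multiple, its second summand having coefficient 0.\<close>

lemma hecke_proj_compress_start:
  assumes "s \<in> S" "q > 0"
  shows "hecke_proj S q s \<circ> start_op S s \<circ> hecke_proj S q s
     = oplin (complex_of_real (q / (1 + q))) (hecke_proj S q s) 0 (hecke_proj S q s)" (is "?A = ?B")
proof (rule bop_ext)
  note bops = bop_comp bop_oplin bop_hecke_proj bop_start
  show bop: "?A \<in> bounded_ops S" "?B \<in> bounded_ops S"
    by (intro assms bops)+
  fix f assume f: "f \<in> l2 S"
  have l2: "hecke_proj S q s f \<in> l2 S" "start_op S s (hecke_proj S q s f) \<in> l2 S"
    by (intro assms f hecke_proj_l2 start_op_l2)+
  show "?A f = ?B f"
  proof
    fix v
    show "?A f v = ?B f v"
    proof (cases "v \<in> coxW S")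
      case True
      obtain k r where k: "k * (1 + r * r) = 1" "complex_of_real (q / (1 + q)) = k * (r * r)" and ap:
        "\<And>f v. f \<in> l2 S \<Longrightarrow> v \<in> coxW S \<Longrightarrow> starts s v \<Longrightarrow>
          hecke_proj S q s f v = k * (r * r * f v + r * f (lmul s v))"
        "\<And>f v. f \<in> l2 S \<Longrightarrow> v \<in> coxW S \<Longrightarrow> \<not> starts s v \<Longrightarrow>
          hecke_proj S q s f v = k * (f v + r * f (lmul s v))"
        using hecke_proj_coeffs[OF assms(2), of S] by metis
      have L: "lmul s v \<in> coxW S" by (rule lmul_in_coxW[OF assms(1) True])
      let ?g = "hecke_proj S q s f" and ?h = "start_op S s (hecke_proj S q s f)"
      have B: "?B f v = k * (r * r) * ?g v"
        by (simp only: oplin_def k(2) mult_zero_left add_0_right)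
      have A: "?A f v = hecke_proj S q s ?h v" by simp
      show ?thesis
      proof (cases "starts s v")
        case st: True
        have "?g v = k * (r * r * f v + r * f (lmul s v))" "?h v = ?g v" "?h (lmul s v) = 0"
          "hecke_proj S q s ?h v = k * (r * r * ?h v + r * ?h (lmul s v))"
          using ap(1)[OF f True st] ap(1)[OF l2(2) True st] st True l2
          by (auto simp: start_op_def starts_lmul)
        then show ?thesis using k(1) A B by algebra
      next
        case st: False
        have "?g v = k * (f v + r * f (lmul s v))" "?g (lmul s v) = k * (r * r * f (lmul s v) + r * f v)"
          "?h v = 0" "?h (lmul s v) = ?g (lmul s v)"
          "hecke_proj S q s ?h v = k * (?h v + r * ?h (lmul s v))"
          using ap(2)[OF f True st] ap(1)[OF f L] ap(2)[OF l2(2) True st] st True l2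
          by (auto simp: start_op_def starts_lmul lmul_lmul)
        then show ?thesis using k(1) A B by algebra
      qed
    next
      case False
      then show ?thesis
        using bop_l2[OF bop(1) f] bop_l2[OF bop(2) f] by (metis l2_outside)
    qed
  qed
qed

text \<open>The complementary line is spanned by (sqrt q, -1), of whose squared length the word
  starting with s carries the fraction 1 / (1 + q).\<close>

lemma hecke_proj_compl_compress_start:
  assumes "s \<in> S" "q > 0"
  shows "compl_op S (hecke_proj S q s) \<circ> start_op S s \<circ> compl_op S (hecke_proj S q s)
     = oplin (complex_of_real (1 / (1 + q))) (compl_op S (hecke_proj S q s)) 0
         (compl_op S (hecke_proj S q s))" (is "?A = ?B")
proof (rule bop_ext)
  let ?c = "compl_op S (hecke_proj S q s)"
  have c: "?c \<in> bounded_ops S"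
    using adj_proj_compl[OF adj_proj_hecke_proj[OF assms]] by (rule proj_bop)
  show bop: "?A \<in> bounded_ops S" "?B \<in> bounded_ops S"
    by (intro c bop_comp bop_oplin bop_start)+
  fix f assume f: "f \<in> l2 S"
  have l2: "?c f \<in> l2 S" "start_op S s (?c f) \<in> l2 S"
    by (intro bop_l2[OF c] start_op_l2 f)+
  show "?A f = ?B f"
  proof
    fix v
    show "?A f v = ?B f v"
    proof (cases "v \<in> coxW S")
      case True
      obtain k r where k: "k * (1 + r * r) = 1" "complex_of_real (1 / (1 + q)) = k" and ap:
        "\<And>f v. f \<in> l2 S \<Longrightarrow> v \<in> coxW S \<Longrightarrow> starts s v \<Longrightarrow>
          hecke_proj S q s f v = k * (r * r * f v + r * f (lmul s v))"
        "\<And>f v. f \<in> l2 S \<Longrightarrow> v \<in> coxW S \<Longrightarrow> \<not> starts s v \<Longrightarrow>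
          hecke_proj S q s f v = k * (f v + r * f (lmul s v))"
        using hecke_proj_coeffs[OF assms(2), of S] by metis
      have L: "lmul s v \<in> coxW S" by (rule lmul_in_coxW[OF assms(1) True])
      let ?g = "?c f" and ?h = "start_op S s (?c f)"
      have g: "?g w = f w - hecke_proj S q s f w" for w
        by (simp add: compl_op_apply f)
      have B: "?B f v = k * ?g v"
        by (simp only: oplin_def k(2) mult_zero_left add_0_right)
      have A: "?A f v = ?h v - hecke_proj S q s ?h v"
        by (simp add: compl_op_apply[OF l2(2)])
      show ?thesis
      proof (cases "starts s v")
        case st: True
        have "hecke_proj S q s f v = k * (r * r * f v + r * f (lmul s v))" "?h v = ?g v" "?h (lmul s v) = 0"
          "hecke_proj S q s ?h v = k * (r * r * ?h v + r * ?h (lmul s v))"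
          using ap(1)[OF f True st] ap(1)[OF l2(2) True st] st True l2
          by (auto simp: start_op_def starts_lmul)
        then show ?thesis using k(1) A B g[of v] by algebra
      next
        case st: False
        have "hecke_proj S q s f v = k * (f v + r * f (lmul s v))"
          "hecke_proj S q s f (lmul s v) = k * (r * r * f (lmul s v) + r * f v)"
          "?h v = 0" "?h (lmul s v) = ?g (lmul s v)"
          "hecke_proj S q s ?h v = k * (?h v + r * ?h (lmul s v))"
          using ap(2)[OF f True st] ap(1)[OF f L] ap(2)[OF l2(2) True st] st True l2
          by (auto simp: start_op_def starts_lmul lmul_lmul)
        then show ?thesis using k(1) A B g[of v] g[of "lmul s v"] by algebra
      qed
    next
      case False
      then show ?thesis
        using bop_l2[OF bop(1) f] bop_l2[OF bop(2) f] by (metis l2_outside)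
    qed
  qed
qed

section \<open>Right multiplication by the generators, inside the commutant\<close>

definition right_gen where
  "right_gen S q s = flip_op S \<circ> hecke_gen S q s \<circ> flip_op S"

lemma bop_right_gen: "s \<in> S \<Longrightarrow> right_gen S q s \<in> bounded_ops S"
  unfolding right_gen_def by (intro bop_comp bop_flip bop_hecke_gen)

lemmas right_gen_l2 = bop_l2[OF bop_right_gen]

definition rmul where "rmul s v = rev (lmul s (rev v))"

lemma rmul_in_coxW: "s \<in> S \<Longrightarrow> v \<in> coxW S \<Longrightarrow> rmul s v \<in> coxW S"
  by (simp add: rmul_def lmul_in_coxW)

lemma right_gen_apply:
  assumes "s \<in> S" "f \<in> l2 S" "v \<in> coxW S"
  shows "right_gen S q s f v = f (rmul s v) + (if starts s (rev v) then complex_of_real (hecke_p q) * f v else 0)"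
proof -
  have l2: "flip_op S f \<in> l2 S" "hecke_gen S q s (flip_op S f) \<in> l2 S"
    by (intro assms bop_l2[OF bop_flip] hecke_gen_l2)+
  have "right_gen S q s f v = hecke_gen S q s (flip_op S f) (rev v)"
    using l2 by (simp add: right_gen_def) (simp add: flip_op_def)
  then show ?thesis
    using assms l2 by (simp add: hecke_gen_apply) (simp add: flip_op_def rmul_def)
qed

text \<open>The first alternative is the case t v = v s, which arises when s = t and v is empty or
  the single letter s; otherwise the two ends of v do not interact. In that exceptional case the
  last conjunct makes the terms with \<open>hecke_p q\<close> agree in
  \<open>right_gen_commute\<close>.\<close>

lemma lmul_rmul_cases:
  assumes "v \<in> coxW S"
  shows "(rmul s v = lmul t v \<and> rmul s (lmul t v) = v \<and> lmul t (rmul s v) = v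
        \<and> (starts s (rev (lmul t v)) \<longleftrightarrow> \<not> starts s (rev v)) \<and> (starts t (rmul s v) \<longleftrightarrow> \<not> starts t v)
        \<and> (starts t v \<longleftrightarrow> starts s (rev v)))
    \<or> (rmul s (lmul t v) = lmul t (rmul s v)
        \<and> (starts s (rev (lmul t v)) \<longleftrightarrow> starts s (rev v)) \<and> (starts t (rmul s v) \<longleftrightarrow> starts t v))"
proof (cases v)
  case Nil
  then show ?thesis by (auto simp: rmul_def lmul_def starts_def)
next
  case (Cons a u)
  show ?thesis
  proof (cases u rule: rev_cases)
    case Nil
    then show ?thesis using Cons by (auto simp: rmul_def lmul_def starts_def)
  next
    case (snoc u' b)
    then show ?thesis using Cons by (auto simp: rmul_def lmul_def starts_def)
  qed
qed

lemma right_gen_commute: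
  assumes "s \<in> S" "t \<in> S" "f \<in> l2 S"
  shows "hecke_gen S q t (right_gen S q s f) = right_gen S q s (hecke_gen S q t f)"
proof
  fix v
  have l2: "right_gen S q s f \<in> l2 S" "hecke_gen S q t f \<in> l2 S"
    "hecke_gen S q t (right_gen S q s f) \<in> l2 S" "right_gen S q s (hecke_gen S q t f) \<in> l2 S"
    by (intro assms right_gen_l2 hecke_gen_l2)+
  show "hecke_gen S q t (right_gen S q s f) v = right_gen S q s (hecke_gen S q t f) v"
  proof (cases "v \<in> coxW S")
    case True
    show ?thesis
      using lmul_rmul_cases[OF True, of s t]
      by (elim disjE) (auto simp: hecke_gen_apply right_gen_apply assms l2 True lmul_in_coxW rmul_in_coxW
          algebra_simps)
  qed (use l2 in \<open>simp add: l2_outside\<close>)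
qed

lemma right_gen_commutant: "s \<in> S \<Longrightarrow> right_gen S q s \<in> commutant S (hecke_gen S q ` S)"
  by (auto simp: commutant_def bop_right_gen right_gen_commute)

section \<open>Elements of the Hecke algebra and the trace property\<close>

lemma vNa_bop: "x \<in> hecke_vNa S q \<Longrightarrow> x \<in> bounded_ops S"
  unfolding hecke_vNa_def by (rule commutant_bop)

lemma hecke_gen_in_vNa: "s \<in> S \<Longrightarrow> hecke_gen S q s \<in> hecke_vNa S q"
  unfolding hecke_vNa_def
  by (rule subsetD[OF commutant_commutant_subset]) (auto simp: bop_hecke_gen)

lemma commutant_subset_bop: "commutant S X \<subseteq> bounded_ops S"
  by (auto simp: commutant_def)

lemma conditional_expectation_vNa:
  assumes "cond_exp S (hecke_vNa S q) E"
  shows "conditional_expectation S (hecke_vNa S q) E"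
  using assms unfolding hecke_vNa_def
  by unfold_locales (erule commutant_bop
      | assumption | rule commutant_idop[OF commutant_subset_bop] commutant_comp[OF commutant_subset_bop]
      commutant_oplin[OF commutant_subset_bop])+

lemma hecke_proj_in_vNa:
  assumes "s \<in> S"
  shows "hecke_proj S q s \<in> hecke_vNa S q"
  using hecke_gen_in_vNa[OF assms, of q] unfolding hecke_proj_def hecke_vNa_def
  by (intro commutant_oplin commutant_idop commutant_subset_bop)

lemma hecke_proj_dirac:
  assumes "s \<in> S" "q > 0"
  shows "hecke_proj S q s (dirac []) = (\<lambda>w. complex_of_real (1 / (1 + q)) * dirac [] w
     + complex_of_real (sqrt q / (1 + q)) * dirac [s] w)"
proof
  fix v
  have l2: "hecke_proj S q s (dirac []) \<in> l2 S" by (intro assms hecke_proj_l2 dirac_Nil_l2)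
  show "hecke_proj S q s (dirac []) v = complex_of_real (1 / (1 + q)) * dirac [] v
     + complex_of_real (sqrt q / (1 + q)) * dirac [s] v"
  proof (cases "v \<in> coxW S")
    case True
    then show ?thesis
      by (cases v; simp add: hecke_proj_apply assms)
        (auto simp: dirac_def starts_def lmul_def)
  next
    case False
    moreover have "v \<noteq> []" "v \<noteq> [s]" using False assms by (auto simp: Cons_in_coxW)
    ultimately show ?thesis using l2 by (simp add: l2_outside dirac_def)
  qed
qed

text \<open>Right multiplication by \<open>T\<^sub>s\<close> commutes with \<open>y\<close>; this is the trace property of
  the vector state at the empty word, for products with \<open>T\<^sub>s\<close>.\<close>
lemma vNa_dirac_singleton:
  assumes "s \<in> S" "y \<in> hecke_vNa S q"
  shows "y (dirac [s]) [] = y (dirac []) [s]"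
proof -
  have R: "right_gen S q s (dirac []) = dirac [s]"
  proof
    fix v
    have "right_gen S q s (dirac []) \<in> l2 S" by (intro assms right_gen_l2 dirac_Nil_l2)
    then show "right_gen S q s (dirac []) v = dirac [s] v"
      using assms(1)
      by (cases "v \<in> coxW S"; cases v rule: rev_cases; simp add: right_gen_apply l2_outside)
        (auto simp: rmul_def lmul_def dirac_def starts_def Cons_in_coxW)
  qed
  have "y (dirac [s]) = right_gen S q s (y (dirac []))"
    using right_gen_commutant[OF assms(1), of q] assms(2) R
    unfolding hecke_vNa_def commutant_def by force
  then show ?thesis
    using bop_l2[OF vNa_bop[OF assms(2)] dirac_Nil_l2] assms(1)
    by (simp add: right_gen_apply rmul_def lmul_def starts_def)
qed

text \<open>The projection maps \<open>dirac []\<close> into the span of \<open>dirac []\<close> and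
  \<open>dirac [s]\<close>, so only \<open>vNa_dirac_singleton\<close> is required.\<close>

lemma hecke_proj_trace:
  assumes "s \<in> S" "q > 0" "y \<in> hecke_vNa S q"
  shows "hecke_proj S q s (y (dirac [])) [] = y (hecke_proj S q s (dirac [])) []"
proof -
  note y = vNa_bop[OF assms(3)]
  have "dirac [s] \<in> l2 S" by (intro dirac_l2) (simp add: Cons_in_coxW assms)
  then have "y (hecke_proj S q s (dirac [])) [] = complex_of_real (1 / (1 + q)) * y (dirac []) []
     + complex_of_real (sqrt q / (1 + q)) * y (dirac []) [s]"
    using assms by (simp only: hecke_proj_dirac bop_lin[OF y] dirac_Nil_l2 vNa_dirac_singleton)
  also have "\<dots> = hecke_proj S q s (y (dirac [])) []"
    using assms bop_l2[OF y dirac_Nil_l2]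
    by (simp add: hecke_proj_apply starts_def lmul_def add_divide_distrib)
  finally show ?thesis by simp
qed

text \<open>By the two compression formulas the value is q / (1 + q) times the trace of the spectral
  projection, which is 1 / (1 + q), plus 1 / (1 + q) times the trace of its complement.\<close>

lemma phi_start:
  assumes "conditional_expectation S (hecke_vNa S q) E" "s \<in> S" "q > 0"
  shows "conditional_expectation.phi E (start_op S s) = complex_of_real (2 * q / (1 + q)\<^sup>2)"
proof -
  interpret conditional_expectation S "hecke_vNa S q" E by fact
  let ?e = "hecke_proj S q s"
  have e: "?e \<in> hecke_vNa S q" by (intro assms hecke_proj_in_vNa)
  note ep = adj_proj_hecke_proj[OF assms(2,3)]
  have ebop: "?e \<in> bounded_ops S" "compl_op S ?e \<in> bounded_ops S"
    by (intro ep proj_bop adj_proj_compl)+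
  have phi_e: "phi ?e = complex_of_real (1 / (1 + q))"
    by (simp add: phi_def E_fix e hecke_proj_dirac assms) (simp add: dirac_def)
  have phi_c: "phi (compl_op S ?e) = 1 - complex_of_real (1 / (1 + q))"
    unfolding compl_op_def by (simp add: phi_oplin bop_idop ebop phi_id phi_e)
  have "phi (start_op S s) = complex_of_real (q / (1 + q)) * complex_of_real (1 / (1 + q))
      + complex_of_real (1 / (1 + q)) * (1 - complex_of_real (1 / (1 + q)))"
    using phi_compression[OF e ep bop_start hecke_proj_trace[OF assms(2,3)], of s]
    unfolding hecke_proj_compress_start[OF assms(2,3)] hecke_proj_compl_compress_start[OF assms(2,3)]
      phi_oplin[OF ebop(1) ebop(1)] phi_oplin[OF ebop(2) ebop(2)] phi_e phi_c
    by simp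
  also have "\<dots> = complex_of_real (q / (1 + q) * (1 / (1 + q)) + 1 / (1 + q) * (1 - 1 / (1 + q)))"
    by simp
  also have "q / (1 + q) * (1 / (1 + q)) + 1 / (1 + q) * (1 - 1 / (1 + q)) = 2 * q / (1 + q)\<^sup>2"
    using assms(3) by (simp add: field_simps power2_eq_square)
  finally show ?thesis .
qed

section \<open>The one-dimensional summand\<close>

lemma finite_words: "finite S \<Longrightarrow> finite {w \<in> coxW S. length w = k}"
  by (rule finite_subset[OF _ finite_lists_length_eq[of S k]])
    (auto simp: coxW_def reduced_word_altdef)

text \<open>A nonempty word is prolonged on the left by any letter other than its first, which
  leaves \<open>card S - 1\<close> choices at each step.\<close>

lemma card_words_le:
  assumes "finite S"
  shows "card {w \<in> coxW S. length w = Suc k} \<le> card S * (card S - 1) ^ k"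
proof (induction k)
  case 0
  have "{w \<in> coxW S. length w = Suc 0} \<subseteq> (\<lambda>s. [s]) ` S"
    by (auto simp: length_Suc_conv Cons_in_coxW)
  then show ?case
    using surj_card_le[OF assms] by simp
next
  case (Suc k)
  let ?A = "{w \<in> coxW S. length w = Suc k}"
  let ?B = "SIGMA w:?A. S - {hd w}"
  have "{w \<in> coxW S. length w = Suc (Suc k)} \<subseteq> (\<lambda>(w, s). s # w) ` ?B"
  proof
    fix w assume "w \<in> {w \<in> coxW S. length w = Suc (Suc k)}"
    then obtain s u where "w = s # u" "s \<in> S - {hd u}" "u \<in> ?A"
      by (cases w) (auto simp: Cons_in_coxW)
    then show "w \<in> (\<lambda>(w, s). s # w) ` ?B" by force
  qed
  moreover have fin: "finite ?B"
    using assms finite_words[OF assms] by (intro finite_SigmaI) auto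
  ultimately have "card {w \<in> coxW S. length w = Suc (Suc k)} \<le> card ?B"
    by (intro surj_card_le)
  also have "\<dots> = (\<Sum>w\<in>?A. card (S - {hd w}))"
    using assms finite_words[OF assms] by (intro card_SigmaI) auto
  also have "\<dots> = (\<Sum>w\<in>?A. card S - 1)"
  proof (rule sum.cong)
    fix w assume "w \<in> ?A"
    then have "hd w \<in> S" by (cases w) (auto simp: Cons_in_coxW)
    then show "card (S - {hd w}) = card S - 1" by simp
  qed simp
  also have "\<dots> \<le> card S * (card S - 1) ^ k * (card S - 1)"
    using Suc.IH by simp
  finally show ?case by (simp add: mult_ac)
qed

text \<open>Grouping by length bounds the sum by 1 plus a geometric series with ratio
  \<open>real (card S - 1) * x\<close>.\<close>

lemma sum_words_le:
  fixes x :: real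
  assumes "finite S" "x \<ge> 0" "real (card S - 1) * x < 1" "finite F" "F \<subseteq> coxW S"
  shows "(\<Sum>w\<in>F. x ^ length w) \<le> 1 + real (card S) * x / (1 - real (card S - 1) * x)"
proof -
  \<comment> \<open>Inserting 0 gives the maximum a value when F is empty.\<close>
  define m where "m = Max (insert 0 (length ` F))"
  have len: "length w \<le> m" if "w \<in> F" for w
    unfolding m_def using that assms(4) by (intro Max_ge) auto
  let ?y = "real (card S - 1) * x"
  have "(\<Sum>w\<in>F. x ^ length w) = (\<Sum>k\<le>m. \<Sum>w\<in>{w \<in> F. length w = k}. x ^ length w)"
    by (rule sum.group[symmetric]) (use assms len in auto)
  also have "\<dots> = (\<Sum>k\<le>m. real (card {w \<in> F. length w = k}) * x ^ k)"
    by (intro sum.cong) auto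
  also have "\<dots> \<le> (\<Sum>k\<le>m. real (card {w \<in> coxW S. length w = k}) * x ^ k)"
    using assms by (intro sum_mono mult_right_mono of_nat_mono card_mono finite_words) auto
  \<comment> \<open>One more nonnegative term is added so that splitting off length 0 leaves the
    index range unchanged.\<close>
  also have "\<dots> \<le> (\<Sum>k\<le>Suc m. real (card {w \<in> coxW S. length w = k}) * x ^ k)"
    using assms(2) by simp
  also have "\<dots> = real (card {w \<in> coxW S. length w = 0}) +
      (\<Sum>k\<le>m. real (card {w \<in> coxW S. length w = Suc k}) * x ^ Suc k)"
    by (subst sum.atMost_Suc_shift) simp
  also have "{w \<in> coxW S. length w = 0} = {[]}" by auto
  also have "(\<Sum>k\<le>m. real (card {w \<in> coxW S. length w = Suc k}) * x ^ Suc k)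
      \<le> (\<Sum>k\<le>m. real (card S * (card S - 1) ^ k) * x ^ Suc k)"
    using assms by (intro sum_mono mult_right_mono of_nat_mono card_words_le) auto
  also have "\<dots> = real (card S) * x * (\<Sum>k\<le>m. ?y ^ k)"
    by (simp add: sum_distrib_left power_mult_distrib mult_ac)
  also have "(\<Sum>k\<le>m. ?y ^ k) \<le> 1 / (1 - ?y)"
    using assms by (simp add: sum_gp0 divide_right_mono)
  finally show ?thesis using assms(2) by (simp add: mult_left_mono)
qed

text \<open>The candidate joint eigenvector for the eigenvalue c, which may be negative: for q > 1
  it will be - 1 / sqrt q.\<close>

definition eta where
  "eta S c w = (if w \<in> coxW S then complex_of_real c ^ length w else 0)"

lemma eta_Nil [simp]: "eta S c [] = 1"
  by (simp add: eta_def)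

text \<open>The norm of the vector stands in a denominator in \<open>phi_dirac_outer_ge\<close>,
  hence the interest in an upper bound.\<close>

lemma eta_l2:
  assumes "finite S" "real (card S - 1) * c\<^sup>2 < 1"
  shows "eta S c \<in> l2 S"
    and "(l2norm S (eta S c))\<^sup>2 \<le> 1 + real (card S) * c\<^sup>2 / (1 - real (card S - 1) * c\<^sup>2)"
proof -
  have eq: "(cmod (eta S c w))\<^sup>2 = (c\<^sup>2) ^ length w" if "w \<in> coxW S" for w
    using that by (simp add: eta_def norm_power power_even_abs flip: power_mult) (simp add: mult.commute)
  have bound: "(\<Sum>w\<in>F. (cmod (eta S c w))\<^sup>2) \<le> 1 + real (card S) * c\<^sup>2 / (1 - real (card S - 1) * c\<^sup>2)"
    if "finite F" "F \<subseteq> coxW S" for F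
  proof -
    have "(\<Sum>w\<in>F. (cmod (eta S c w))\<^sup>2) = (\<Sum>w\<in>F. (c\<^sup>2) ^ length w)"
      using that eq by (intro sum.cong) auto
    then show ?thesis using sum_words_le[OF assms(1) _ assms(2) that] by simp
  qed
  have summable: "(\<lambda>w. (cmod (eta S c w))\<^sup>2) summable_on coxW S"
    by (rule nonneg_bdd_above_summable_on) (use bound in \<open>auto intro!: bdd_aboveI2\<close>)
  then show "eta S c \<in> l2 S" by (simp add: l2_def eta_def)
  show "(l2norm S (eta S c))\<^sup>2 \<le> 1 + real (card S) * c\<^sup>2 / (1 - real (card S - 1) * c\<^sup>2)"
    unfolding l2norm_sq by (rule infsum_le_finite_sums[OF summable bound])
qed

text \<open>At a word not starting with s the equation just adds one letter. At a word starting with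
  s, after division by a power of c, it is the quadratic equation assumed for c.\<close>

lemma hecke_gen_eta:
  assumes "s \<in> S" "eta S c \<in> l2 S" "c\<^sup>2 = 1 + hecke_p q * c"
  shows "hecke_gen S q s (eta S c) = (\<lambda>w. complex_of_real c * eta S c w)"
proof
  fix v
  have l2: "hecke_gen S q s (eta S c) \<in> l2 S" by (rule hecke_gen_l2[OF assms(1,2)])
  show "hecke_gen S q s (eta S c) v = complex_of_real c * eta S c v"
  proof (cases "v \<in> coxW S")
    case v: True
    have L: "lmul s v \<in> coxW S" by (rule lmul_in_coxW[OF assms(1) v])
    show ?thesis
    proof (cases "starts s v")
      case True
      then obtain u where u: "v = s # u" by (cases v) (auto simp: starts_def)
      have "complex_of_real c * complex_of_real c = 1 + complex_of_real (hecke_p q) * complex_of_real c"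
        using arg_cong[OF assms(3), of complex_of_real] by (simp add: power2_eq_square)
      then have "z + complex_of_real (hecke_p q) * (complex_of_real c * z)
         = complex_of_real c * (complex_of_real c * z)" for z
        by algebra
      then show ?thesis
        using u v L True by (simp add: hecke_gen_apply assms(2)) (simp add: eta_def lmul_def)
    next
      case False
      then have "lmul s v = s # v" by (auto simp: starts_def lmul_def)
      then show ?thesis
        using v L False by (simp add: hecke_gen_apply assms(2)) (simp add: eta_def)
    qed
  next
    case False
    then show ?thesis by (simp add: l2_outside[OF l2] eta_def)
  qed
qed

text \<open>When su is reduced, the eigenvalue equation for s, evaluated at u, says h(su) = c h(u);
  the value at the empty word therefore determines h.\<close>

lemma joint_eigenvector_unique:
  assumes "h \<in> l2 S" "\<And>s. s \<in> S \<Longrightarrow> hecke_gen S q s h = (\<lambda>w. complex_of_real c * h w)"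
  shows "h = (\<lambda>w. h [] * eta S c w)"
proof -
  have "h w = h [] * complex_of_real c ^ length w" if "w \<in> coxW S" for w
    using that
  proof (induction w)
    case (Cons s u)
    then have su: "s \<in> S" "u \<in> coxW S" "\<not> starts s u"
      by (auto simp: Cons_in_coxW starts_def)
    then have "lmul s u = s # u" by (auto simp: starts_def lmul_def)
    then have "h (s # u) = hecke_gen S q s h u"
      using su by (simp add: hecke_gen_apply assms(1))
    also have "\<dots> = complex_of_real c * h u" by (simp add: assms(2)[OF su(1)])
    finally show ?case using Cons.IH su by simp
  qed simp
  note eq = this
  show ?thesis
  proof
    show "h w = h [] * eta S c w" for w
      unfolding eta_def using eq[of w] l2_outside[OF assms(1), of w] by (cases "w \<in> coxW S") simp_all
  qed
qed

lemma hecke_gen_dirac: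
  assumes "s # u \<in> coxW S"
  shows "hecke_gen S q s (dirac u) = dirac (s # u)"
proof
  fix v
  have su: "s \<in> S" "u \<in> coxW S" "\<not> starts s u"
    using assms by (auto simp: Cons_in_coxW starts_def)
  have l2: "hecke_gen S q s (dirac u) \<in> l2 S" by (rule hecke_gen_l2[OF su(1) dirac_l2[OF su(2)]])
  have su': "lmul s u = s # u" using su by (auto simp: starts_def lmul_def)
  show "hecke_gen S q s (dirac u) v = dirac (s # u) v"
  proof (cases "v \<in> coxW S")
    case True
    have "lmul s v = u \<longleftrightarrow> v = s # u"
      using lmul_lmul[OF True, of s] lmul_lmul[OF su(2), of s] su' by metis
    then show ?thesis using su True
      by (simp add: hecke_gen_apply dirac_l2) (auto simp: dirac_def)
  next
    case False
    then have "v \<noteq> s # u" using assms by auto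
    then show ?thesis by (simp add: l2_outside[OF l2 False]) (simp add: dirac_def)
  qed
qed

text \<open>Finitely supported vectors are dense: linearity gives the claim for truncations of f,
  and the bound controls the remaining tail.\<close>

lemma functional_eq_0:
  fixes G :: "('a list \<Rightarrow> complex) \<Rightarrow> complex"
  assumes lin: "\<And>f g c d. f \<in> l2 S \<Longrightarrow> g \<in> l2 S \<Longrightarrow> G (\<lambda>w. c * f w + d * g w) = c * G f + d * G g"
    and bound: "\<And>f. f \<in> l2 S \<Longrightarrow> cmod (G f) \<le> C * l2norm S f" and C: "C \<ge> 0"
    and 0: "\<And>w. w \<in> coxW S \<Longrightarrow> G (dirac w) = 0"
    and f: "f \<in> l2 S"
  shows "G f = 0"
proof -
  have trunc: "(\<lambda>w. if w \<in> F then f w else 0) \<in> l2 S \<and> G (\<lambda>w. if w \<in> F then f w else 0) = 0"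
    if "finite F" "F \<subseteq> coxW S" for F
    using that
  proof (induction F)
    case empty
    then show ?case using lin[of "\<lambda>_. 0" "\<lambda>_. 0" 0 0] by simp
  next
    case (insert a F)
    let ?t = "\<lambda>w. if w \<in> F then f w else 0"
    have eq: "(\<lambda>w. if w \<in> insert a F then f w else 0) = (\<lambda>w. 1 * ?t w + f a * dirac a w)"
      using insert.hyps by (auto simp: dirac_def fun_eq_iff)
    have "?t \<in> l2 S" "dirac a \<in> l2 S" using insert by (auto intro: dirac_l2)
    note l2 = this
    have "G ?t = 0" "G (dirac a) = 0" using insert 0[of a] by auto
    then show ?case
      unfolding eq lin[OF l2] using l2_lin[OF l2, of 1 "f a"] by simp
  qed
  have "cmod (G f) \<le> C * e" if e: "e > 0" for e
  proof -
    let ?s = "\<lambda>w. (cmod (f w))\<^sup>2"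
    obtain F where F: "finite F" "F \<subseteq> coxW S" "dist (sum ?s F) (infsum ?s (coxW S)) \<le> e\<^sup>2"
      using infsum_finite_approximation[OF l2_summable[OF f], of "e\<^sup>2"] e by auto
    let ?t = "\<lambda>w. if w \<in> F then f w else 0"
    let ?d = "\<lambda>w. f w - ?t w"
    have t: "?t \<in> l2 S" "G ?t = 0" using trunc[OF F(1,2)] by auto
    have d: "?d \<in> l2 S" by (rule l2_diff[OF f t(1)])
    have "(l2norm S ?d)\<^sup>2 = (\<Sum>\<^sub>\<infinity>w\<in>coxW S - F. ?s w)"
      unfolding l2norm_sq by (rule infsum_cong_neutral) auto
    also have "\<dots> = infsum ?s (coxW S) - sum ?s F"
      using infsum_Diff[of ?s "coxW S" F] l2_summable[OF f] F by simp
    also have "\<dots> \<le> e\<^sup>2" using F(3) by (simp add: dist_real_def abs_le_iff)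
    finally have "l2norm S ?d \<le> e"
      by (rule power2_le_imp_le) (use e in simp)
    moreover have "G f = G ?d"
      using lin[OF f t(1), of 1 "-1"] t(2) by simp
    ultimately show ?thesis
      using bound[OF d] mult_left_mono[of "l2norm S ?d" e C] C by simp
  qed
  note le = this
  have "cmod (G f) \<le> 0"
  proof (rule ccontr)
    assume neg: "\<not> cmod (G f) \<le> 0"
    \<comment> \<open>Chosen so that C * e stays below \<open>cmod (G f)\<close>; adding 1 to C
      keeps the denominator positive when C = 0.\<close>
    define e where "e = cmod (G f) / (2 * (C + 1))"
    have "e > 0" using neg C by (simp add: e_def)
    then have "cmod (G f) \<le> C * e" by (rule le)
    also have "\<dots> < (2 * (C + 1)) * e"
      using \<open>e > 0\<close> C by (intro mult_strict_right_mono) auto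
    also have "\<dots> = cmod (G f)" using C by (simp add: e_def)
    finally show False by simp
  qed
  then show ?thesis by simp
qed

text \<open>The orthogonal projection onto the line of \<open>eta S c\<close>; the scalar
  compensates for this vector not being normalised.\<close>

definition eta_proj where
  "eta_proj S c = outer S (\<lambda>w. complex_of_real (1 / (l2norm S (eta S c))\<^sup>2) * eta S c w) (eta S c)"

lemma l2norm_eta_pos:
  assumes "eta S c \<in> l2 S"
  shows "0 < l2norm S (eta S c)"
  using cmod_le_l2norm[OF assms, of "[]"] by simp

section \<open>The central projection onto the joint eigenvector\<close>

context
  fixes S :: "'a set" and c q :: real
  assumes eta: "eta S c \<in> l2 S" and c: "c\<^sup>2 = 1 + hecke_p q * c"
begin

lemma eta_proj_apply:
  "f \<in> l2 S \<Longrightarrow> eta_proj S c f = (\<lambda>w. ip S f (eta S c) * (complex_of_real (1 / (l2norm S (eta S c))\<^sup>2) * eta S c w))"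
  by (simp add: eta_proj_def outer_def)

lemma adj_proj_eta_proj: "adj_proj S (eta_proj S c)"
  unfolding adj_proj_def
proof (intro conjI ballI)
  let ?h = "\<lambda>w. complex_of_real (1 / (l2norm S (eta S c))\<^sup>2) * eta S c w"
  have h: "?h \<in> l2 S" by (rule l2_scale[OF eta])
  show bop: "eta_proj S c \<in> bounded_ops S"
    unfolding eta_proj_def by (rule bop_outer[OF h eta])
  have h_eta: "ip S ?h (eta S c) = 1"
    using l2norm_eta_pos[OF eta] by (simp add: ip_scale_left[OF eta eta] ip_self[OF eta] del: of_real_divide)
      (simp flip: of_real_mult of_real_power)
  have "ip S (\<lambda>w. a * ?h w) (eta S c) = a" for a
    by (simp only: ip_scale_left[OF h eta] h_eta mult_1_right)
  then show "eta_proj S c (eta_proj S c f) = eta_proj S c f" if "f \<in> l2 S" for f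
    using bop_l2[OF bop that] that by (simp only: eta_proj_apply)
  fix f g assume fg: "f \<in> l2 S" "g \<in> l2 S"
  have 1: "ip S (eta_proj S c f) g
      = ip S f (eta S c) * (complex_of_real (1 / (l2norm S (eta S c))\<^sup>2) * ip S (eta S c) g)"
    by (simp only: eta_proj_apply[OF fg(1)] ip_scale_left[OF h fg(2)] ip_scale_left[OF eta fg(2)])
  have "ip S (eta_proj S c g) f
      = ip S g (eta S c) * (complex_of_real (1 / (l2norm S (eta S c))\<^sup>2) * ip S (eta S c) f)"
    by (simp only: eta_proj_apply[OF fg(2)] ip_scale_left[OF h fg(1)] ip_scale_left[OF eta fg(1)])
  then have "ip S f (eta_proj S c g)
      = cnj (ip S g (eta S c) * (complex_of_real (1 / (l2norm S (eta S c))\<^sup>2) * ip S (eta S c) f))"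
    by (subst ip_cnj) simp
  also have "\<dots> = ip S (eta S c) g * (complex_of_real (1 / (l2norm S (eta S c))\<^sup>2) * ip S f (eta S c))"
    by (simp only: complex_cnj_mult complex_cnj_complex_of_real ip_cnj[symmetric])
  finally show "ip S (eta_proj S c f) g = ip S f (eta_proj S c g)"
    unfolding 1 by (simp only: mult_ac)
qed

text \<open>\<open>T\<^sub>s\<close> scales the eigenvector by c and, being self-adjoint with c
  real, scales the functional pairing with it by c too; both products are thus c times the
  projection.\<close>

lemma eta_proj_in_commutant: "eta_proj S c \<in> commutant S (hecke_gen S q ` S)"
proof (rule commutantI[OF proj_bop[OF adj_proj_eta_proj]])
  fix A f assume "A \<in> hecke_gen S q ` S" and f: "f \<in> l2 S"
  then obtain s where s: "s \<in> S" and A: "A = hecke_gen S q s" by auto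
  let ?N = "complex_of_real (1 / (l2norm S (eta S c))\<^sup>2)"
  note T = bop_hecke_gen[OF s, of q]
  have "A (eta_proj S c f) = (\<lambda>w. ip S f (eta S c) * (?N * (complex_of_real c * eta S c w)))"
    unfolding A eta_proj_apply[OF f] bop_scale[OF T l2_scale[OF eta]] bop_scale[OF T eta]
      hecke_gen_eta[OF s eta c] ..
  moreover have "ip S (hecke_gen S q s f) (eta S c) = complex_of_real c * ip S f (eta S c)"
    using ip_lin_right[OF eta eta f, of "complex_of_real c" 0]
    by (simp add: ip_hecke_gen[OF s f eta] hecke_gen_eta[OF s eta c])
  ultimately show "A (eta_proj S c f) = eta_proj S c (A f)"
    unfolding A eta_proj_apply[OF bop_l2[OF T f]] by (simp add: mult_ac)
qed

text \<open>An operator A commuting with all \<open>T\<^sub>s\<close> maps the eigenvector to a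
  joint eigenvector, hence to a multiple of itself. Pairing A g with the eigenvector is likewise a
  multiple of pairing g with it, and the two scalars agree, so A commutes with the
  projection.\<close>

lemma eta_proj_in_vNa: "eta_proj S c \<in> hecke_vNa S q"
  unfolding hecke_vNa_def
proof (rule commutantI[OF proj_bop[OF adj_proj_eta_proj]])
  fix A f assume A: "A \<in> commutant S (hecke_gen S q ` S)" and f: "f \<in> l2 S"
  let ?h = "eta S c"
  note bop = commutant_bop[OF A]
  have comm: "hecke_gen S q s (A g) = A (hecke_gen S q s g)" if "s \<in> S" "g \<in> l2 S" for s g
    using commutant_commute[OF A _ that(2)] that(1) by blast
  have Ah: "A ?h \<in> l2 S" by (rule bop_l2[OF bop eta])
  have "hecke_gen S q s (A ?h) = (\<lambda>w. complex_of_real c * A ?h w)" if "s \<in> S" for s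
    unfolding comm[OF that eta] hecke_gen_eta[OF that eta c] by (rule bop_scale[OF bop eta])
  then have Aeta: "A ?h = (\<lambda>w. A ?h [] * ?h w)"
    by (rule joint_eigenvector_unique[OF Ah])
  \<comment> \<open>The scalar for the pairing, read off at the empty word; the induction below
    carries it to all words by moving \<open>T\<^sub>s\<close> through A and onto the
    eigenvector.\<close>
  define mu where "mu = ip S (A (dirac [])) ?h"
  have dirac: "ip S (A (dirac w)) ?h = mu * complex_of_real c ^ length w" if "w \<in> coxW S" for w
    using that
  proof (induction w)
    case (Cons s u)
    then have su: "s \<in> S" "u \<in> coxW S" by (auto simp: Cons_in_coxW)
    have u: "dirac u \<in> l2 S" "A (dirac u) \<in> l2 S"
      by (rule dirac_l2[OF su(2)], rule bop_l2[OF bop dirac_l2[OF su(2)]])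
    have "ip S (A (dirac (s # u))) ?h = ip S (A (dirac u)) (hecke_gen S q s ?h)"
      unfolding hecke_gen_dirac[OF Cons.prems, of q, symmetric] comm[OF su(1) u(1), symmetric]
      by (rule ip_hecke_gen[OF su(1) u(2) eta])
    also have "\<dots> = complex_of_real c * ip S (A (dirac u)) ?h"
      using ip_lin_right[OF eta eta u(2), of "complex_of_real c" 0]
      by (simp add: hecke_gen_eta[OF su(1) eta c])
    finally show ?case using Cons.IH[OF su(2)] by simp
  qed (simp add: mu_def)
  \<comment> \<open>A bounded functional that vanishes on the basis vectors, set up for
    \<open>functional_eq_0\<close>.\<close>
  define G where "G g = ip S (A g) ?h - mu * ip S g ?h" for g
  obtain C where C: "C \<ge> 0" "\<And>g. g \<in> l2 S \<Longrightarrow> l2norm S (A g) \<le> C * l2norm S g"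
    using bop_bound[OF bop] by blast
  have G: "G g = 0" if g: "g \<in> l2 S" for g
  proof (rule functional_eq_0[where G = G, OF _ _ _ _ g])
    fix f1 f2 a b assume "f1 \<in> l2 S" "f2 \<in> l2 S"
    then show "G (\<lambda>w. a * f1 w + b * f2 w) = a * G f1 + b * G f2"
      by (simp add: G_def bop_lin[OF bop] ip_lin_left bop_l2[OF bop] eta algebra_simps)
  next
    fix g assume g: "g \<in> l2 S"
    have "cmod (G g) \<le> cmod (ip S (A g) ?h) + cmod (mu * ip S g ?h)"
      unfolding G_def by (rule norm_triangle_ineq4)
    also have "\<dots> \<le> l2norm S (A g) * l2norm S ?h + cmod mu * (l2norm S g * l2norm S ?h)"
      unfolding norm_mult
      by (intro add_mono mult_left_mono ip_le[OF bop_l2[OF bop g] eta] ip_le[OF g eta] norm_ge_zero)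
    also have "\<dots> \<le> (C * l2norm S g) * l2norm S ?h + cmod mu * (l2norm S g * l2norm S ?h)"
      by (intro add_mono mult_right_mono C(2) g) auto
    finally show "cmod (G g) \<le> ((C + cmod mu) * l2norm S ?h) * l2norm S g"
      by (simp add: algebra_simps)
  next
    show "0 \<le> (C + cmod mu) * l2norm S ?h" using C(1) by simp
  next
    fix w assume w: "w \<in> coxW S"
    show "G (dirac w) = 0"
      unfolding G_def dirac[OF w] ip_dirac_left[OF w] using w by (simp add: eta_def)
  qed
  have ipA: "ip S (A g) ?h = mu * ip S g ?h" if "g \<in> l2 S" for g
    using G[OF that] by (simp add: G_def)
  \<comment> \<open>Pairing the image of the eigenvector with the eigenvector itself identifies the
    two scalars.\<close>
  have "A ?h [] * ip S ?h ?h = mu * ip S ?h ?h"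
    using arg_cong[OF Aeta, of "\<lambda>g. ip S g ?h"] by (simp only: ip_scale_left[OF eta eta] ipA[OF eta])
  moreover have "ip S ?h ?h \<noteq> 0"
    using l2norm_eta_pos[OF eta] by (simp add: ip_self[OF eta])
  ultimately have mu: "A ?h [] = mu" by simp
  have "A (eta_proj S c f)
      = (\<lambda>w. ip S f ?h * (complex_of_real (1 / (l2norm S ?h)\<^sup>2) * A ?h w))"
    unfolding eta_proj_apply[OF f] bop_scale[OF bop l2_scale[OF eta]] bop_scale[OF bop eta] ..
  also have "\<dots> = eta_proj S c (A f)"
    unfolding eta_proj_apply[OF bop_l2[OF bop f]] ipA[OF f] by (subst Aeta) (simp only: mu mult_ac)
  finally show "A (eta_proj S c f) = eta_proj S c (A f)" .
qed

text \<open>Compressing the projection onto the empty word by the central projection z gives N z,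
  where N is the inverse squared norm of the eigenvector. The trace of z is also N, so this part
  contributes N^2, and the complementary compression contributes a nonnegative amount.\<close>

lemma phi_dirac_outer_ge:
  assumes "conditional_expectation S (hecke_vNa S q) E"
  shows "1 / ((l2norm S (eta S c))\<^sup>2)\<^sup>2 \<le> Re (conditional_expectation.phi E (outer S (dirac []) (dirac [])))"
proof -
  interpret conditional_expectation S "hecke_vNa S q" E by fact
  let ?z = "eta_proj S c" and ?d = "dirac [] :: 'a list \<Rightarrow> complex"
  let ?N = "complex_of_real (1 / (l2norm S (eta S c))\<^sup>2)"
  note z = eta_proj_in_vNa and zp = adj_proj_eta_proj and zc = adj_proj_compl[OF adj_proj_eta_proj]
  note zb = proj_bop[OF zp] and zcb = proj_bop[OF zc]
  have zd: "?z ?d = (\<lambda>w. ?N * eta S c w)"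
    by (simp add: eta_proj_apply ip_dirac_left)
  have zd2: "?z ?d \<in> l2 S" "compl_op S ?z ?d \<in> l2 S"
    by (rule bop_l2[OF zb dirac_Nil_l2], rule bop_l2[OF zcb dirac_Nil_l2])
  \<comment> \<open>The trace property against z follows from z lying in the commutant.\<close>
  have comm: "?z (y ?d) [] = y (?z ?d) []" if "y \<in> hecke_vNa S q" for y
    using commutant_commute[OF that[unfolded hecke_vNa_def] eta_proj_in_commutant dirac_Nil_l2] by simp
  have "?z \<circ> outer S ?d ?d \<circ> ?z = outer S (?z ?d) (?z ?d)"
    by (simp add: comp_outer[OF zb dirac_Nil_l2] outer_comp[OF zp dirac_Nil_l2])
  also have "\<dots> = oplin ?N ?z 0 ?z"
  proof
    fix f
    show "outer S (?z ?d) (?z ?d) f = oplin ?N ?z 0 ?z f"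
    proof (cases "f \<in> l2 S")
      case True
      have "ip S f (?z ?d) = ?N * ip S f (eta S c)"
        unfolding zd using ip_lin_right[OF eta eta True, of ?N 0] by simp
      then show ?thesis
        using True by (simp only: outer_def if_True oplin_def eta_proj_apply[OF True] zd mult_zero_left add_0_right)
          (simp only: mult_ac)
    qed (simp add: outer_def oplin_def bop_outside[OF zb])
  qed
  finally have 1: "phi (?z \<circ> outer S ?d ?d \<circ> ?z) = ?N * ?N"
    by (simp only: phi_oplin[OF zb zb]) (simp add: phi_def E_fix[OF z] zd)
  have "compl_op S ?z \<circ> outer S ?d ?d \<circ> compl_op S ?z = outer S (compl_op S ?z ?d) (compl_op S ?z ?d)"
    by (simp add: comp_outer[OF zcb dirac_Nil_l2] outer_comp[OF zc dirac_Nil_l2])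
  moreover have "l2norm S (compl_op S ?z ?d) \<le> 1"
    using proj_norm_le[OF zc dirac_Nil_l2] by (simp add: l2norm_dirac)
  ultimately have 2: "0 \<le> Re (phi (compl_op S ?z \<circ> outer S ?d ?d \<circ> compl_op S ?z))"
    using phi_outer_nonneg[OF zd2(2)] by simp
  have "phi (outer S ?d ?d) = ?N * ?N + phi (compl_op S ?z \<circ> outer S ?d ?d \<circ> compl_op S ?z)"
    using phi_compression[OF z zp bop_outer[OF dirac_Nil_l2 dirac_Nil_l2] comm] unfolding 1 .
  also have "?N * ?N = complex_of_real (1 / ((l2norm S (eta S c))\<^sup>2)\<^sup>2)"
    by (simp add: power2_eq_square)
  finally have "phi (outer S ?d ?d) = complex_of_real (1 / ((l2norm S (eta S c))\<^sup>2)\<^sup>2)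
    + phi (compl_op S ?z \<circ> outer S ?d ?d \<circ> compl_op S ?z)" .
  from arg_cong[OF this, of Re] 2 show ?thesis
    unfolding plus_complex.sel Re_complex_of_real by linarith
qed

end

section \<open>Total mass of the state and the final contradiction\<close>

lemma phi_start_sum:
  assumes "conditional_expectation S (hecke_vNa S q) E" "finite S" "q > 0"
  shows "Re (conditional_expectation.phi E (outer S (dirac []) (dirac [])))
    + real (card S) * (2 * q / (1 + q)\<^sup>2) = 1"
proof -
  interpret conditional_expectation S "hecke_vNa S q" E by fact
  \<comment> \<open>The projection onto the empty word and the words starting in T. Adding letters
    one at a time adds the operators \<open>start_op S s\<close>, and T = S yields the
    identity.\<close>
  let ?P = "\<lambda>T f. if f \<in> l2 S then (\<lambda>w. if w = [] \<or> hd w \<in> T then f w else 0) else (\<lambda>_. 0)"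
  define K where "K = complex_of_real (2 * q / (1 + q)\<^sup>2)"
  let ?o = "outer S (dirac []) (dirac [])"
  have "?P T \<in> bounded_ops S \<and> phi (?P T) = phi ?o + of_nat (card T) * K"
    if "finite T" "T \<subseteq> S" for T
    using that
  proof (induction T)
    case empty
    have "?P {} = ?o"
      by (intro ext) (simp add: outer_def ip_dirac_right, simp add: dirac_def)
    moreover have "?o \<in> bounded_ops S" by (rule bop_outer) simp_all
    ultimately show ?case by simp
  next
    case (insert s T)
    have "?P (insert s T) = oplin 1 (?P T) 1 (start_op S s)"
      using insert.hyps by (auto simp: oplin_def start_op_def starts_def fun_eq_iff)
    moreover have "oplin 1 (?P T) 1 (start_op S s) \<in> bounded_ops S"
      by (rule bop_oplin) (use insert in \<open>auto simp: bop_start\<close>)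
    moreover have "phi (oplin 1 (?P T) 1 (start_op S s))
        = phi ?o + of_nat (card T) * K + K"
      using phi_oplin[of "?P T" "start_op S s" 1 1] phi_start[OF assms(1) _ assms(3), folded K_def, of s] insert
      by (simp add: bop_start)
    moreover have "card (insert s T) = Suc (card T)" using insert.hyps by simp
    ultimately show ?case by (simp add: algebra_simps)
  qed
  from this[OF assms(2) order_refl]
  have "phi (?P S) = phi ?o + of_nat (card S) * K" by simp
  moreover have "?P S = idop S"
  proof
    fix f
    show "?P S f = idop S f"
      using l2_outside[of f S]
      by (auto simp: idop_def fun_eq_iff) (metis Cons_in_coxW list.collapse)
  qed
  ultimately have "1 = phi ?o + of_nat (card S) * K"
    by (simp only: phi_id)
  from arg_cong[OF this, of Re] show ?thesis by (simp add: K_def)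
qed

theorem theorem4p5:
  fixes S :: "'a set" and q :: real
  assumes "finite S" and "card S \<ge> 3" and "q > 0"
  shows "\<not> injective_vNa S (hecke_vNa S q)"
proof
  assume "injective_vNa S (hecke_vNa S q)"
  then obtain E where ce: "cond_exp S (hecke_vNa S q) E"
    unfolding injective_vNa_def by blast
  note cex = conditional_expectation_vNa[OF ce]
  interpret conditional_expectation S "hecke_vNa S q" E by (rule cex)
  define a where "a = Re (phi (outer S (dirac []) (dirac [])))"
  define m where "m = real (card S - 1)"
  \<comment> \<open>Having at least three generators enters here; both cases below rest on m \<ge>
    2.\<close>
  have m: "m \<ge> 2" "real (card S) = m + 1" using assms(2) by (auto simp: m_def)
  \<comment> \<open>c is an eigenvalue of \<open>T\<^sub>s\<close> with modulus at most 1: sqrt q if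
    q \<le> 1, and - 1 / sqrt q otherwise. Its square is q or 1/q, and q / (1 + q)^2 is unchanged
    under inversion of q.\<close>
  obtain c where c: "c\<^sup>2 = 1 + hecke_p q * c" and x: "0 < c\<^sup>2" "c\<^sup>2 \<le> 1"
    and qx: "q / (1 + q)\<^sup>2 = c\<^sup>2 / (1 + c\<^sup>2)\<^sup>2"
  proof (cases "q \<le> 1")
    case True
    show ?thesis
      by (rule that[of "sqrt q"]) (use True assms(3) in \<open>auto simp: hecke_p_def\<close>)
  next
    case False
    show ?thesis
    proof (rule that[of "- 1 / sqrt q"])
      have "sqrt q * sqrt q = q" using assms(3) by simp
      then show "(- 1 / sqrt q)\<^sup>2 = 1 + hecke_p q * (- 1 / sqrt q)"
        using assms(3) by (simp add: hecke_p_def power_divide field_simps)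
      show "q / (1 + q)\<^sup>2 = (- 1 / sqrt q)\<^sup>2 / (1 + (- 1 / sqrt q)\<^sup>2)\<^sup>2"
        using assms(3) by (simp add: power_divide field_simps power2_eq_square)
    qed (use False in \<open>auto simp: power_divide\<close>)
  qed
  define x where "x = c\<^sup>2"
  note xs = x[folded x_def]
  have "a + (m + 1) * (2 * (q / (1 + q)\<^sup>2)) = 1"
    using phi_start_sum[OF cex assms(1,3)] by (simp add: a_def m(2))
  then have eq: "a * (1 + x)\<^sup>2 + 2 * (m + 1) * x = (1 + x)\<^sup>2"
    unfolding qx x_def[symmetric] using xs by (simp add: field_simps)
  show False
  proof (cases "m * x < 1")
    case True
    have lt: "real (card S - 1) * c\<^sup>2 < 1" using True by (simp add: m_def x_def)
    note eta = eta_l2[OF assms(1) lt]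
    define N where "N = (l2norm S (eta S c))\<^sup>2"
    have N: "0 < N" using l2norm_eta_pos[OF eta(1)] by (simp add: N_def)
    have "N \<le> 1 + (m + 1) * x / (1 - m * x)"
      using eta(2) unfolding N_def m_def[symmetric] m(2) x_def .
    also have "\<dots> = (1 + x) / (1 - m * x)"
      using True by (simp add: field_simps)
    finally have "N * (1 - m * x) \<le> 1 + x" using True by (simp add: field_simps)
    then have "(N * (1 - m * x))\<^sup>2 \<le> (1 + x)\<^sup>2"
      using N True by (intro power_mono) auto
    then have "N\<^sup>2 * (1 - m * x)\<^sup>2 \<le> (1 + x)\<^sup>2"
      by (simp only: power_mult_distrib)
    then have "(1 - m * x)\<^sup>2 \<le> 1 / N\<^sup>2 * (1 + x)\<^sup>2"
      using N by (simp add: pos_le_divide_eq mult.commute)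
    also have "\<dots> \<le> a * (1 + x)\<^sup>2"
      using phi_dirac_outer_ge[OF eta(1) c cex] by (intro mult_right_mono) (auto simp: a_def N_def)
    \<comment> \<open>Combines the lower bound for a with the total mass; after expansion everything
      cancels except (m x)^2 \<le> x^2, contradicting m \<ge> 2 and x > 0.\<close>
    finally have "(1 - m * x)\<^sup>2 + 2 * (m + 1) * x \<le> (1 + x)\<^sup>2" using eq by simp
    then have "(m * x)\<^sup>2 \<le> x\<^sup>2" by (simp add: power2_eq_square algebra_simps)
    then have "m * x \<le> x" by (rule power2_le_imp_le) (use xs in simp)
    then show False using xs m by simp
  next
    case False
    have "a \<ge> 0"
      unfolding a_def by (rule phi_outer_nonneg) (simp_all add: l2norm_dirac)
    then have "0 \<le> a * (1 + x)\<^sup>2" by simp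
    then have "2 * (m * x) \<le> 1 + x\<^sup>2"
      using eq by (simp add: power2_sum algebra_simps)
    \<comment> \<open>Together, 2 m x \<le> 1 + x^2 \<le> 1 + x \<le> 1 + m x / 2, which is
      impossible when m x \<ge> 1.\<close>
    moreover have "2 * x \<le> m * x" using m xs by (intro mult_right_mono) auto
    moreover have "x\<^sup>2 \<le> x" using xs by (simp add: power2_eq_square mult_left_le)
    ultimately show False using False xs by linarith
  qed
qed

end
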